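(* Let $p$ be a prime and $d\in\mathbb{N}$. For any $r\in\mathbb{N}$ and $\boldsymbol{v}:=[x,y,z]\in\mathbb{H}_d(\mathbb{Z}_p)$, we have $$\mathbf{1}_{\boldsymbol{v}\cdot\mathbb{H}_d(p^r\mathbb{Z}_p)}=\sum_{\substack{\gamma\in\mathbb{Q}_p/\mathbb{Z}_p\\ |\gamma|_p\le p^r}}\ \Bigg(\sum_{\substack{(\alpha,\beta)\in\mathbb{Q}_p^{2d}/|\gamma|_p^{-1}\mathbb{Z}_p^{2d}\\ |\alpha|_p,|\beta|_p\le p^r}}\ \Bigg(\sum_{k\in\mathbb{Z}_p^d/|\gamma|_p\mathbb{Z}_p^d}\frac{|\gamma|_p^d\, e^{-2\pi i\{\gamma(z+ky)+x\alpha+y\beta\}_p}}{p^{r(2d+1)}}\,\big(\chi_{(\alpha,\beta,\gamma)}\big)_{k+P_\gamma(x),\,k}\Bigg)\Bigg).$$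
   Context: For a ring $A$ (here $A=\mathbb{Z}_p$ or a subring $p^r\mathbb{Z}_p$), $\mathbb{H}_d(A)$ is the Heisenberg group of matrices $$[x,y,z]=\begin{bmatrix}1&x^t&z\\0&I_d&y\\0&0&1\end{bmatrix},\quad x,y\in A^d,\ z\in A,$$ under matrix multiplication, where $I_d$ is the $d\times d$ identity matrix. $\mathbf{1}_B$ denotes a characteristic function. Products such as $ky$, $x\alpha$, $y\beta$ of vectors of length $d$ denote the sum of the coordinatewise products. $|\cdot|_p$ is the $\ell_\infty$-norm on $\mathbb{Q}_p^n$ induced by the $p$-adic norm. For $u=\sum_{k\ge i}u_kp^k\in\mathbb{Q}_p$ ($0\le u_k\le p-1$), $\{u\}_p=\sum_{k=i}^{-1}u_kp^k$ if $i\le-1$ and $\{u\}_p=0$ if $i\ge0$ ($p$-adic fractional part). Each class in $\widehat{\mathbb{Z}_p}\cong\mathbb{Q}_p/\mathbb{Z}_p$ is identified with its representative in $\{1\}\cup\{\sum_{k=1}^\infty\lambda_kp^{-k}:0\le\lambda_k\le p-1,\ 1\le\sum_k\lambda_k<\infty\}$; in particular the trivial class is represented by $1$, so $|\gamma|_p\ge1$ for all $\gamma\in\mathbb{Q}_p/\mathbb{Z}_p$. Here $|\gamma|_p$ is a power of $p$, viewed as a scalar in $\mathbb{Q}_p$ when writing $|\gamma|_p\mathbb{Z}_p^d$ and $|\gamma|_p^{-1}\mathbb{Z}_p^{2d}$. The pairs $(\alpha,\beta)\in\mathbb{Q}_p^{2d}/|\gamma|_p^{-1}\mathbb{Z}_p^{2d}$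 (with $\alpha,\beta$ of length $d$) are likewise represented by elements of $\widehat{\mathbb{Z}_p}^{2d}$, one for each class. $P_\gamma:\mathbb{Z}_p^d\to\mathbb{Z}_p^d/|\gamma|_p\mathbb{Z}_p^d$ is the quotient map. For such $(\alpha,\beta,\gamma)$, $\chi_{(\alpha,\beta,\gamma)}$ is the irreducible unitary representation of $\mathbb{H}_d(\mathbb{Z}_p)$ on $\mathcal{H}_\gamma=\mathrm{span}\{|\gamma|_p^{d/2}\mathbf{1}_{k+|\gamma|_p\mathbb{Z}_p^d}:k\in\mathbb{Z}_p^d/|\gamma|_p\mathbb{Z}_p^d\}\subset L^2(\mathbb{Z}_p^d)$ given by $$(\chi_{(\alpha,\beta,\gamma)}[a,b,c]\varphi)(w)=e^{2\pi i\{\alpha a+\beta b+\gamma(c+wb)\}_p}\varphi(w+a),$$ and its matrix coefficients, indexed by $k,k'\in\mathbb{Z}_p^d/|\gamma|_p\mathbb{Z}_p^d$, are the functions $$\big(\chi_{(\alpha,\beta,\gamma)}\big)_{k,k'}([a,b,c])=e^{2\pi i\{\gamma(c+k'b)+(a\alpha+b\beta)\}_p}\,\mathbf{1}_{k-k'+|\gamma|_p\mathbb{Z}_p^d}(a),\qquad [a,b,c]\in\mathbb{H}_d(\mathbb{Z}_p).$$ *)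

theory Defs
  imports
    "HOL-Analysis.Analysis"
    "HOL-Computational_Algebra.Fraction_Field"
    "Berlekamp_Zassenhaus.Finite_Field"
begin

section \<open>The $p$-adic integers\<close>

text \<open>The prime is $p$ = \<^term>\<open>CARD('p)\<close> for a type \<^typ>\<open>'p\<close> of class
  \<^class>\<open>prime_card\<close>.  The ring $\mathbb{Z}_p$ is the inverse limit of the rings
  $\mathbb{Z}/p^n\mathbb{Z}$, with residues modulo $p^n$ taken in $[0, p^n)$.\<close>

definition coherent :: "int \<Rightarrow> (nat \<Rightarrow> int) \<Rightarrow> bool" where
  "coherent q f \<longleftrightarrow> (\<forall>n. 0 \<le> f n \<and> f n < q ^ n \<and> f (Suc n) mod q ^ n = f n)"

lemma coherent_modI:
  fixes f :: "nat \<Rightarrow> int"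
  assumes "q > 0" "\<And>n. f (Suc n) mod q ^ n = f n mod q ^ n"
  shows "coherent q (\<lambda>n. f n mod q ^ n)"
  unfolding coherent_def
proof (intro allI conjI)
  fix n
  have "q ^ n > 0" using assms(1) by simp
  then show "0 \<le> f n mod q ^ n" "f n mod q ^ n < q ^ n" by simp_all
  have "f (Suc n) mod q ^ Suc n mod q ^ n = f (Suc n) mod q ^ n"
    by (rule mod_mod_cancel) simp
  then show "f (Suc n) mod q ^ Suc n mod q ^ n = f n mod q ^ n"
    by (simp only: assms(2))
qed

lemma coherent_add:
  assumes "coherent q f" "coherent q g" "q > 0"
  shows "coherent q (\<lambda>n. (f n + g n) mod q ^ n)"
proof (rule coherent_modI)
  fix n
  have "f (Suc n) mod q ^ n = f n mod q ^ n" "g (Suc n) mod q ^ n = g n mod q ^ n"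
    using assms unfolding coherent_def by (metis mod_mod_trivial)+
  then show "(f (Suc n) + g (Suc n)) mod q ^ n = (f n + g n) mod q ^ n"
    by (rule mod_add_cong)
qed fact

lemma coherent_mult:
  assumes "coherent q f" "coherent q g" "q > 0"
  shows "coherent q (\<lambda>n. (f n * g n) mod q ^ n)"
proof (rule coherent_modI)
  fix n
  have "f (Suc n) mod q ^ n = f n mod q ^ n" "g (Suc n) mod q ^ n = g n mod q ^ n"
    using assms unfolding coherent_def by (metis mod_mod_trivial)+
  then show "(f (Suc n) * g (Suc n)) mod q ^ n = (f n * g n) mod q ^ n"
    by (rule mod_mult_cong)
qed fact

lemma coherent_uminus:
  assumes "coherent q f" "q > 0"
  shows "coherent q (\<lambda>n. (- f n) mod q ^ n)"
proof (rule coherent_modI)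
  fix n
  have "f (Suc n) mod q ^ n = f n mod q ^ n"
    using assms unfolding coherent_def by (metis mod_mod_trivial)
  then show "(- f (Suc n)) mod q ^ n = (- f n) mod q ^ n"
    by (rule mod_minus_cong)
qed fact

lemma p_gt_1: "int CARD('p::prime_card) > 1"
  using prime_card_int[where 'a='p] prime_gt_1_int by blast

typedef (overloaded) ('p::prime_card) padic_int =
  "{f :: nat \<Rightarrow> int. coherent (int CARD('p)) f}"
  by (rule exI[of _ "\<lambda>_. 0"]) (simp add: coherent_def)

setup_lifting type_definition_padic_int

instantiation padic_int :: (prime_card) comm_ring_1
begin

lift_definition zero_padic_int :: "'a padic_int" is "\<lambda>_. 0" by (simp add: coherent_def)

lift_definition one_padic_int :: "'a padic_int" is "\<lambda>n. 1 mod int CARD('a) ^ n"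
  by (rule coherent_modI) simp_all

lift_definition plus_padic_int :: "'a padic_int \<Rightarrow> 'a padic_int \<Rightarrow> 'a padic_int"
  is "\<lambda>f g n. (f n + g n) mod int CARD('a) ^ n"
  by (rule coherent_add) simp_all

lift_definition times_padic_int :: "'a padic_int \<Rightarrow> 'a padic_int \<Rightarrow> 'a padic_int"
  is "\<lambda>f g n. (f n * g n) mod int CARD('a) ^ n"
  by (rule coherent_mult) simp_all

lift_definition uminus_padic_int :: "'a padic_int \<Rightarrow> 'a padic_int"
  is "\<lambda>f n. (- f n) mod int CARD('a) ^ n"
  by (rule coherent_uminus) simp_all

definition minus_padic_int :: "'a padic_int \<Rightarrow> 'a padic_int \<Rightarrow> 'a padic_int"
  where "minus_padic_int a b = a + (- b)"

instance
proof
  fix a b c :: "'a padic_int"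
  show "a * b * c = a * (b * c)"
    by transfer (simp only: mod_mult_left_eq mod_mult_right_eq mult.assoc)
  show "a * b = b * a" by transfer (simp only: mult.commute)
  show "1 * a = a" by transfer (simp add: mod_mult_left_eq fun_eq_iff coherent_def)
  show "(a + b) * c = a * c + b * c"
    by transfer (simp only: mod_mult_left_eq mod_add_eq distrib_right)
  show "a + b + c = a + (b + c)"
    by transfer (simp only: mod_add_left_eq mod_add_right_eq add.assoc)
  show "a + b = b + a" by transfer (simp only: add.commute)
  show "0 + a = a" by transfer (simp add: fun_eq_iff coherent_def)
  show "- a + a = 0" by transfer (simp add: mod_add_left_eq)
  show "a - b = a + - b" by (rule minus_padic_int_def)
  show "(0 :: 'a padic_int) \<noteq> 1"
  proof transfer
    have "(0::int) \<noteq> 1 mod int CARD('a) ^ 1"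
      using p_gt_1[where 'p='a] by simp
    then show "(\<lambda>_. 0) \<noteq> (\<lambda>n. 1 mod int CARD('a) ^ n)" by metis
  qed
qed

end

lift_definition padic_res :: "'p::prime_card padic_int \<Rightarrow> nat \<Rightarrow> int" is "\<lambda>f n. f n" .

lemma padic_res_bounds: "0 \<le> padic_res a n" "padic_res (a::'p::prime_card padic_int) n < int CARD('p) ^ n"
  by (transfer, auto simp: coherent_def)+

lemma padic_res_mod: "m \<le> n \<Longrightarrow> padic_res (a::'p::prime_card padic_int) n mod int CARD('p) ^ m = padic_res a m"
proof (induction n rule: nat_induct)
  case 0
  then show ?case using padic_res_bounds[of a 0] by simp
next
  case (Suc n)
  have *: "padic_res a (Suc n) mod int CARD('p) ^ n = padic_res a n" by transfer (auto simp: coherent_def)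
  show ?case
  proof (cases "m = Suc n")
    case True
    then show ?thesis using padic_res_bounds[of a "Suc n"] by simp
  next
    case False
    with Suc.prems have "m \<le> n" by simp
    with Suc.IH have "padic_res a m = padic_res a (Suc n) mod int CARD('p) ^ n mod int CARD('p) ^ m"
      using * by simp
    then show ?thesis using \<open>m \<le> n\<close> by (simp add: mod_mod_cancel le_imp_power_dvd)
  qed
qed

lemma padic_res_eqI: "(\<And>n. padic_res a n = padic_res b n) \<Longrightarrow> a = b"
  by transfer auto

lemma padic_res_0 [simp]: "padic_res 0 n = 0"
  by (simp only: padic_res.rep_eq zero_padic_int.rep_eq)

lemma padic_res_1: "padic_res (1::'p::prime_card padic_int) n = 1 mod int CARD('p) ^ n"
  by (simp only: padic_res.rep_eq one_padic_int.rep_eq)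

lemma padic_res_add:
  "padic_res (a + b) n = (padic_res a n + padic_res (b::'p::prime_card padic_int) n) mod int CARD('p) ^ n"
  by (simp only: padic_res.rep_eq plus_padic_int.rep_eq)

lemma padic_res_mult:
  "padic_res (a * b) n = (padic_res a n * padic_res (b::'p::prime_card padic_int) n) mod int CARD('p) ^ n"
  by (simp only: padic_res.rep_eq times_padic_int.rep_eq)

lemma padic_res_uminus:
  "padic_res (- a) n = (- padic_res (a::'p::prime_card padic_int) n) mod int CARD('p) ^ n"
  by (simp only: padic_res.rep_eq uminus_padic_int.rep_eq)

lemma padic_res_diff:
  "padic_res (a - b) n = (padic_res a n - padic_res (b::'p::prime_card padic_int) n) mod int CARD('p) ^ n"
  unfolding minus_padic_int_def padic_res_add padic_res_uminus mod_add_right_eq by (simp only: diff_conv_add_uminus)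

lemma padic_res_of_nat: "padic_res (of_nat k :: 'p::prime_card padic_int) n = int k mod int CARD('p) ^ n"
proof (induction k)
  case (Suc k)
  have "padic_res (of_nat (Suc k) :: 'p padic_int) n = (1 mod int CARD('p) ^ n + int k mod int CARD('p) ^ n) mod int CARD('p) ^ n"
    by (simp only: of_nat_Suc padic_res_add padic_res_1 Suc)
  also have "\<dots> = int (Suc k) mod int CARD('p) ^ n" by (simp only: mod_add_eq of_nat_Suc)
  finally show ?case .
qed simp

lemma padic_res_power:
  "padic_res (of_nat CARD('p) ^ m * a :: 'p::prime_card padic_int) n
    = (int CARD('p) ^ m * padic_res a n) mod int CARD('p) ^ n"
  using padic_res_of_nat[where 'p='p, of "CARD('p) ^ m" n] by (simp add: padic_res_mult mod_mult_left_eq)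

lemma padic_res_exists:
  assumes "\<And>n. f (Suc n) mod int CARD('p::prime_card) ^ n = f n mod int CARD('p) ^ n"
  shows "\<exists>a::'p padic_int. \<forall>n. padic_res a n = f n mod int CARD('p) ^ n"
proof -
  have "coherent (int CARD('p)) (\<lambda>n. f n mod int CARD('p) ^ n)"
    using assms by (intro coherent_modI) auto
  then show ?thesis
    by (intro exI[of _ "Abs_padic_int (\<lambda>n. f n mod int CARD('p) ^ n)"])
      (auto simp: padic_res.rep_eq Abs_padic_int_inverse)
qed

text \<open>Divisibility by $p^m$ is vanishing of the residue modulo $p^m$.\<close>

lemma padic_int_dvd_iff:
  fixes a :: "'p::prime_card padic_int"
  shows "of_nat CARD('p) ^ m dvd a \<longleftrightarrow> padic_res a m = 0"
proof
  assume "of_nat CARD('p) ^ m dvd a"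
  then obtain b where "a = of_nat CARD('p) ^ m * b" by (auto simp only: dvd_def)
  then show "padic_res a m = 0" by (simp add: padic_res_power)
next
  let ?p = "int CARD('p)"
  assume 0: "padic_res a m = 0"
  have dv: "?p ^ m dvd padic_res a (m + n)" for n
    using padic_res_mod[of m "m + n" a] 0 by auto
  define f where "f n = padic_res a (m + n) div ?p ^ m" for n
  have fm: "padic_res a (m + n) = ?p ^ m * f n" for n
    using dv by (simp add: f_def)
  have "f (Suc n) mod ?p ^ n = f n mod ?p ^ n" for n
  proof -
    have "(?p ^ m * f (Suc n)) mod ?p ^ (m + n) = ?p ^ m * f n mod ?p ^ (m + n)"
      using padic_res_mod[of "m + n" "m + Suc n" a] fm[of n] fm[of "Suc n"]
        padic_res_bounds[of a "m + n"] by simp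
    then have "?p ^ m * (f (Suc n) mod ?p ^ n) = ?p ^ m * (f n mod ?p ^ n)"
      by (simp only: power_add mult_mod_right)
    then show ?thesis using p_gt_1[where 'p='p] by simp
  qed
  from padic_res_exists[of f, OF this] obtain b :: "'p padic_int"
    where b: "\<And>n. padic_res b n = f n mod ?p ^ n" by auto
  have "a = of_nat CARD('p) ^ m * b"
  proof (rule padic_res_eqI)
    fix n
    have "padic_res (of_nat CARD('p) ^ m * b) n = (?p ^ m * f n) mod ?p ^ n"
      by (simp add: padic_res_power b mod_mult_right_eq)
    also have "\<dots> = padic_res a n" unfolding fm[symmetric] by (rule padic_res_mod) simp
    finally show "padic_res a n = padic_res (of_nat CARD('p) ^ m * b) n" by simp
  qed
  then show "of_nat CARD('p) ^ m dvd a" by simp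
qed

lemma padic_int_unit:
  fixes a :: "'p::prime_card padic_int"
  assumes "padic_res a 1 \<noteq> 0"
  shows "a dvd 1"
proof -
  let ?p = "int CARD('p)"
  have "\<exists>g. [padic_res a n * g = 1] (mod ?p ^ n)" for n
  proof (cases "n = 0")
    case False
    have "\<not> ?p dvd padic_res a n"
      using padic_res_mod[of 1 n a] False assms by auto
    then have "coprime (padic_res a n) (?p ^ n)"
      using prime_card_int[where 'a='p] by (metis coprime_commute coprime_power_right_iff prime_imp_coprime)
    then show ?thesis by (simp add: cong_solve_coprime_int)
  qed simp
  then obtain g where g: "\<And>n. [padic_res a n * g n = 1] (mod ?p ^ n)" by metis
  have "g (Suc n) mod ?p ^ n = g n mod ?p ^ n" for n
  proof -
    have 1: "[padic_res a (Suc n) = padic_res a n] (mod ?p ^ n)"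
      using padic_res_mod[of n "Suc n" a] padic_res_bounds[of a n] by (simp add: cong_def)
    have "[padic_res a (Suc n) * g (Suc n) = 1] (mod ?p ^ n)"
      using g[of "Suc n"] by (rule cong_dvd_modulus) simp
    then have 2: "[padic_res a n * g (Suc n) = 1] (mod ?p ^ n)"
      using 1 by (metis cong_scalar_right cong_sym cong_trans)
    have "[g n * (padic_res a n * g (Suc n)) = g n * 1] (mod ?p ^ n)" using 2 by (rule cong_scalar_left)
    moreover have "[g (Suc n) * (padic_res a n * g n) = g (Suc n) * 1] (mod ?p ^ n)"
      using g by (rule cong_scalar_left)
    ultimately show ?thesis unfolding cong_def by (simp add: ac_simps)
  qed
  from padic_res_exists[of g, OF this] obtain b :: "'p padic_int"
    where b: "\<And>n. padic_res b n = g n mod ?p ^ n" by auto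
  have "a * b = 1"
    using g by (intro padic_res_eqI) (simp add: padic_res_mult b padic_res_1 mod_mult_right_eq cong_def)
  then show ?thesis by (metis dvdI)
qed

lemma padic_int_decompose:
  fixes a :: "'p::prime_card padic_int"
  assumes "a \<noteq> 0"
  shows "\<exists>m b. a = of_nat CARD('p) ^ m * b \<and> padic_res b 1 \<noteq> 0"
proof -
  have "\<exists>n. padic_res a n \<noteq> 0" using assms padic_res_eqI[of a 0] by auto
  define n where "n = (LEAST n. padic_res a n \<noteq> 0)"
  have n: "padic_res a n \<noteq> 0" unfolding n_def by (rule LeastI_ex) fact
  have less: "padic_res a k = 0" if "k < n" for k using that not_less_Least unfolding n_def by blast
  have "padic_res a 0 = 0" using padic_res_bounds[of a 0] by simp
  with n obtain m where m: "n = Suc m" by (cases n) auto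
  with less have "padic_res a m = 0" by simp
  then obtain b where b: "a = of_nat CARD('p) ^ m * b" by (metis padic_int_dvd_iff dvdE)
  have "padic_res b 1 \<noteq> 0"
  proof
    assume "padic_res b 1 = 0"
    then obtain c where "b = of_nat CARD('p) ^ 1 * c" by (metis padic_int_dvd_iff dvdE)
    with b have "a = of_nat CARD('p) ^ n * c" by (simp add: m ac_simps)
    with n show False using padic_int_dvd_iff[of n a] by simp
  qed
  with b show ?thesis by blast
qed

instance padic_int :: (prime_card) idom
proof
  fix a b :: "'a padic_int"
  assume "a \<noteq> 0" "b \<noteq> 0"
  then obtain m c n d where a: "a = of_nat CARD('a) ^ m * c" "padic_res c 1 \<noteq> 0"
    and b: "b = of_nat CARD('a) ^ n * d" "padic_res d 1 \<noteq> 0"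
    using padic_int_decompose by metis
  obtain c' d' where c': "1 = c * c'" and d': "1 = d * d'"
    using a b padic_int_unit by (metis dvdE)
  have "a * b * (c' * d') = of_nat CARD('a) ^ (m + n) * (c * c') * (d * d')"
    by (simp add: a b power_add ac_simps)
  also have "\<dots> = of_nat (CARD('a) ^ (m + n))"
    by (simp flip: c' d')
  also have "\<dots> \<noteq> 0"
  proof
    assume "(of_nat (CARD('a) ^ (m + n)) :: 'a padic_int) = 0"
    then have "int (CARD('a) ^ (m + n)) mod int CARD('a) ^ Suc (m + n) = 0"
      by (metis padic_res_0 padic_res_of_nat)
    then show False using p_gt_1[where 'p='a] by (simp add: mod_eq_0_iff_dvd power_dvd_imp_le dvd_def)
  qed
  finally show "a * b \<noteq> 0" by auto
qed

section \<open>The field of $p$-adic numbers\<close>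

typedef (overloaded) ('p::prime_card) padic = "UNIV :: 'p padic_int fract set" ..

setup_lifting type_definition_padic

instantiation padic :: (prime_card) field
begin

lift_definition zero_padic :: "'a padic" is 0 .
lift_definition one_padic :: "'a padic" is 1 .
lift_definition plus_padic :: "'a padic \<Rightarrow> 'a padic \<Rightarrow> 'a padic" is "(+)" .
lift_definition times_padic :: "'a padic \<Rightarrow> 'a padic \<Rightarrow> 'a padic" is "(*)" .
lift_definition minus_padic :: "'a padic \<Rightarrow> 'a padic \<Rightarrow> 'a padic" is "(-)" .
lift_definition uminus_padic :: "'a padic \<Rightarrow> 'a padic" is uminus .
lift_definition inverse_padic :: "'a padic \<Rightarrow> 'a padic" is inverse .
lift_definition divide_padic :: "'a padic \<Rightarrow> 'a padic \<Rightarrow> 'a padic" is "(div)" .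

instance
proof
  fix a b c :: "'a padic"
  show "a * b * c = a * (b * c)" by transfer (rule mult.assoc)
  show "a * b = b * a" by transfer (rule mult.commute)
  show "1 * a = a" by transfer (rule mult_1)
  show "(a + b) * c = a * c + b * c" by transfer (rule distrib_right)
  show "a + b + c = a + (b + c)" by transfer (rule add.assoc)
  show "a + b = b + a" by transfer (rule add.commute)
  show "0 + a = a" by transfer (rule add_0)
  show "- a + a = 0" by transfer (rule left_minus)
  show "a - b = a + - b" by transfer (rule diff_conv_add_uminus)
  show "(0 :: 'a padic) \<noteq> 1" by transfer (rule zero_neq_one)
  show "a \<noteq> 0 \<Longrightarrow> inverse a * a = 1" by transfer (rule left_inverse)
  have "Rep_padic (a div b) = Rep_padic (a * inverse b)"
    unfolding divide_padic.rep_eq times_padic.rep_eq inverse_padic.rep_eq by (rule divide_inverse)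
  then show "a div b = a * inverse b" by (rule Rep_padic_inject[THEN iffD1])
  have "Rep_padic (inverse (0 :: 'a padic)) = Rep_padic 0"
    unfolding inverse_padic.rep_eq zero_padic.rep_eq by (rule inverse_zero)
  then show "inverse (0 :: 'a padic) = 0" by (rule Rep_padic_inject[THEN iffD1])
qed

end

definition padic_of_int :: "'p::prime_card padic_int \<Rightarrow> 'p padic" where
  "padic_of_int a = Abs_padic (Fract a 1)"

definition Zp :: "'p::prime_card padic set" where
  "Zp = range padic_of_int"

lemma padic_of_int_0 [simp]: "padic_of_int 0 = 0"
  by (simp add: padic_of_int_def zero_padic_def Zero_fract_def)

lemma padic_of_int_1 [simp]: "padic_of_int 1 = 1"
  by (simp add: padic_of_int_def one_padic_def One_fract_def)

lemma padic_of_int_add: "padic_of_int (a + b) = padic_of_int a + padic_of_int b"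
  by (simp add: padic_of_int_def plus_padic.abs_eq)

lemma padic_of_int_mult: "padic_of_int (a * b) = padic_of_int a * padic_of_int b"
  by (simp add: padic_of_int_def times_padic.abs_eq)

lemma padic_of_int_uminus: "padic_of_int (- a) = - padic_of_int a"
  by (simp add: padic_of_int_def uminus_padic.abs_eq)

lemma padic_of_int_diff: "padic_of_int (a - b) = padic_of_int a - padic_of_int b"
  by (simp add: padic_of_int_def minus_padic.abs_eq)

lemma padic_of_int_of_nat [simp]: "padic_of_int (of_nat n) = of_nat n"
  by (induction n) (simp_all add: padic_of_int_add)

lemma padic_of_int_power: "padic_of_int (a ^ n) = padic_of_int a ^ n"
  by (induction n) (simp_all add: padic_of_int_mult)

lemma padic_of_int_eq_iff [simp]: "padic_of_int a = padic_of_int b \<longleftrightarrow> a = b"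
  by (simp add: padic_of_int_def Abs_padic_inject eq_fract)

lemma Zp_0 [simp]: "0 \<in> Zp" and Zp_1 [simp]: "1 \<in> Zp"
  unfolding Zp_def by (metis padic_of_int_0 rangeI, metis padic_of_int_1 rangeI)

lemma Zp_add: "a \<in> Zp \<Longrightarrow> b \<in> Zp \<Longrightarrow> a + b \<in> Zp"
  unfolding Zp_def by (auto simp flip: padic_of_int_add)

lemma Zp_mult: "a \<in> Zp \<Longrightarrow> b \<in> Zp \<Longrightarrow> a * b \<in> Zp"
  unfolding Zp_def by (auto simp flip: padic_of_int_mult)

lemma Zp_uminus: "a \<in> Zp \<Longrightarrow> - a \<in> Zp"
  unfolding Zp_def by (auto simp flip: padic_of_int_uminus)

lemma Zp_diff: "a \<in> Zp \<Longrightarrow> b \<in> Zp \<Longrightarrow> a - b \<in> Zp"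
  unfolding Zp_def by (auto simp flip: padic_of_int_diff)

lemma Zp_of_nat [simp]: "of_nat n \<in> Zp"
  unfolding Zp_def by (metis padic_of_int_of_nat rangeI)

lemma Zp_power: "a \<in> Zp \<Longrightarrow> a ^ n \<in> Zp"
  by (induction n) (simp_all add: Zp_mult)

lemma Zp_sum: "(\<And>i. i \<in> I \<Longrightarrow> f i \<in> Zp) \<Longrightarrow> sum f I \<in> Zp"
  by (induction I rule: infinite_finite_induct) (simp_all add: Zp_add)

lemma of_nat_diff_Zp:
  assumes "of_nat a - of_nat b = of_nat CARD('p) ^ k * (w :: 'p::prime_card padic)" "w \<in> Zp"
  shows "a mod CARD('p) ^ k = b mod CARD('p) ^ k"
proof -
  obtain v where v: "w = padic_of_int v" using assms(2) by (auto simp: Zp_def)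
  have "padic_of_int (of_nat a) = padic_of_int (of_nat b + of_nat CARD('p) ^ k * v)"
    unfolding padic_of_int_add padic_of_int_mult padic_of_int_power padic_of_int_of_nat
    using assms(1) v by (simp add: algebra_simps)
  then have "(of_nat a :: 'p padic_int) = of_nat b + of_nat CARD('p) ^ k * v"
    by (simp only: padic_of_int_eq_iff)
  then have "padic_res (of_nat a :: 'p padic_int) k = padic_res (of_nat b + of_nat CARD('p) ^ k * v) k"
    by (rule arg_cong)
  then have "int a mod int CARD('p) ^ k = int b mod int CARD('p) ^ k"
    by (simp add: padic_res_of_nat padic_res_add padic_res_power)
  then have "int (a mod CARD('p) ^ k) = int (b mod CARD('p) ^ k)"
    by (simp add: of_nat_mod)
  then show ?thesis by simp
qed

lemma of_nat_p_neq_0 [simp]: "(of_nat CARD('p) :: 'p::prime_card padic) \<noteq> 0"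
proof
  assume 0: "(of_nat CARD('p) :: 'p padic) = 0"
  have "CARD('p) mod CARD('p) ^ 2 = 0 mod CARD('p) ^ 2"
    by (rule of_nat_diff_Zp[of _ _ _ 0]) (simp_all add: 0)
  moreover have "CARD('p) < CARD('p) ^ 2"
    using p_gt_1[where 'p='p] by (simp add: power2_eq_square)
  ultimately show False using p_gt_1[where 'p='p] by simp
qed

lemma padic_decompose:
  fixes x :: "'p::prime_card padic"
  assumes "x \<noteq> 0"
  shows "\<exists>n u v. x = of_nat CARD('p) powi n * u \<and> u \<in> Zp \<and> v \<in> Zp \<and> u * v = 1"
proof -
  have "\<exists>a b. b \<noteq> 0 \<and> x = padic_of_int a / padic_of_int b"
  proof (cases x)
    case (Abs_padic y)
    obtain a b where "y = Fract a b" "b \<noteq> 0" by (cases y)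
    then have "x = padic_of_int a / padic_of_int b"
      by (simp add: Abs_padic padic_of_int_def divide_padic.abs_eq)
    then show ?thesis using \<open>b \<noteq> 0\<close> by blast
  qed
  then obtain a b where ab: "b \<noteq> 0" "x = padic_of_int a / padic_of_int b" by auto
  with assms have "a \<noteq> 0" by auto
  with ab(1) obtain m c n d where a: "a = of_nat CARD('p) ^ m * c" "padic_res c 1 \<noteq> 0"
    and b: "b = of_nat CARD('p) ^ n * d" "padic_res d 1 \<noteq> 0"
    using padic_int_decompose by metis
  obtain c' d' where c': "1 = c * c'" and d': "1 = d * d'"
    using a b padic_int_unit by (metis dvdE)
  let ?o = padic_of_int
  have cc: "?o c * ?o c' = 1" and dd: "?o d * ?o d' = 1"
    using c' d' by (metis padic_of_int_1 padic_of_int_mult)+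
  then have [simp]: "?o d \<noteq> 0" by auto
  have inv: "?o d' = inverse (?o d)" using dd by (simp add: field_simps)
  have "x = of_nat CARD('p) ^ m * ?o c / (of_nat CARD('p) ^ n * ?o d)"
    by (simp add: ab(2) a(1) b(1) padic_of_int_mult padic_of_int_power)
  also have "\<dots> = of_nat CARD('p) powi (int m - int n) * (?o c * ?o d')"
    by (simp add: power_int_diff inv field_simps)
  finally have x: "x = of_nat CARD('p) powi (int m - int n) * (?o c * ?o d')" .
  have "?o c * ?o d' * (?o c' * ?o d) = (?o c * ?o c') * (?o d * ?o d')"
    by (simp only: ac_simps)
  then have "?o c * ?o d' * (?o c' * ?o d) = 1" by (simp add: cc dd)
  moreover have "?o c * ?o d' \<in> Zp" "?o c' * ?o d \<in> Zp"
    by (auto intro!: Zp_mult) (simp_all add: Zp_def)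
  ultimately show ?thesis using x by blast
qed

text \<open>The additive valuation: the largest $n$ with $u \in p^n \mathbb{Z}_p$, for $u \neq 0$.\<close>

definition padic_val :: "'p::prime_card padic \<Rightarrow> int" where
  "padic_val u = (GREATEST n. u \<in> (*) (of_nat CARD('p) powi n) ` Zp)"

definition padic_norm :: "'p::prime_card padic \<Rightarrow> real" where
  "padic_norm u = (if u = 0 then 0 else real CARD('p) powi (- padic_val u))"

text \<open>The power $|u|_p$ of $p$ (for $u \neq 0$) read as a scalar of $\mathbb{Q}_p$.\<close>

definition padic_abs :: "'p::prime_card padic \<Rightarrow> 'p padic" where
  "padic_abs u = (if u = 0 then 0 else of_nat CARD('p) powi (- padic_val u))"

lemma Zp_powi: "n \<ge> 0 \<Longrightarrow> of_nat CARD('p) powi n \<in> (Zp :: 'p::prime_card padic set)"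
  by (cases n) (auto intro: Zp_power)

lemma powi_Zp_mono:
  assumes "m \<le> n"
  shows "(*) (of_nat CARD('p) powi n) ` Zp \<subseteq> (*) (of_nat CARD('p) powi m) ` (Zp :: 'p::prime_card padic set)"
proof
  fix x :: "'p padic"
  assume "x \<in> (*) (of_nat CARD('p) powi n) ` Zp"
  then obtain w where w: "w \<in> Zp" "x = of_nat CARD('p) powi n * w" by auto
  have "x = of_nat CARD('p) powi m * (of_nat CARD('p) powi (n - m) * w)"
    using w by (simp add: power_int_diff)
  moreover have "of_nat CARD('p) powi (n - m) * w \<in> Zp"
    using w assms by (intro Zp_mult Zp_powi) auto
  ultimately show "x \<in> (*) (of_nat CARD('p) powi m) ` Zp" by blast
qed

lemma powi_Zp_iff:
  fixes x :: "'p::prime_card padic"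
  assumes x: "x = of_nat CARD('p) powi n * u" "u \<in> Zp" "v \<in> Zp" "u * v = 1"
  shows "x \<in> (*) (of_nat CARD('p) powi m) ` Zp \<longleftrightarrow> m \<le> n"
proof
  assume "m \<le> n"
  then show "x \<in> (*) (of_nat CARD('p) powi m) ` Zp"
    using powi_Zp_mono[of m n, where 'p='p] x(1,2) by auto
next
  assume "x \<in> (*) (of_nat CARD('p) powi m) ` Zp"
  then obtain w where w: "w \<in> Zp" "x = of_nat CARD('p) powi m * w" by auto
  show "m \<le> n"
  proof (rule ccontr)
    assume "\<not> m \<le> n"
    then have mn: "m - n - 1 \<ge> 0" by simp
    have "u = of_nat CARD('p) powi (m - n) * w"
      using x(1) w(2) by (simp add: power_int_diff field_simps)
    also have "of_nat CARD('p) powi (m - n) = of_nat CARD('p) * (of_nat CARD('p) powi (m - n - 1) :: 'p padic)"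
      by (simp add: power_int_diff)
    finally have "1 = of_nat CARD('p) * (of_nat CARD('p) powi (m - n - 1) * w * v)"
      using x(4) by (simp add: ac_simps)
    then have "of_nat 1 - of_nat 0 = of_nat CARD('p) ^ 1 * (of_nat CARD('p) powi (m - n - 1) * w * v)"
      by simp
    moreover have "of_nat CARD('p) powi (m - n - 1) * w * v \<in> Zp"
      using mn w(1) x(3) by (intro Zp_mult Zp_powi)
    ultimately have "1 mod CARD('p) ^ 1 = 0 mod CARD('p) ^ 1"
      by (rule of_nat_diff_Zp)
    then show False using p_gt_1[where 'p='p] by simp
  qed
qed

lemma padic_val_iff:
  fixes x :: "'p::prime_card padic"
  assumes "x \<noteq> 0"
  shows "x \<in> (*) (of_nat CARD('p) powi m) ` Zp \<longleftrightarrow> m \<le> padic_val x"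
proof -
  obtain n u v where x: "x = of_nat CARD('p) powi n * u" "u \<in> Zp" "v \<in> Zp" "u * v = 1"
    using padic_decompose[OF assms] by blast
  have "padic_val x = n"
    unfolding padic_val_def powi_Zp_iff[OF x] by (rule Greatest_equality) auto
  then show ?thesis using powi_Zp_iff[OF x] by simp
qed

lemma padic_norm_le_iff:
  fixes x :: "'p::prime_card padic"
  shows "padic_norm x \<le> real CARD('p) powi (- m) \<longleftrightarrow> x \<in> (*) (of_nat CARD('p) powi m) ` Zp"
proof (cases "x = 0")
  case True
  then show ?thesis by (auto simp: padic_norm_def image_iff intro!: bexI[of _ 0])
next
  case False
  have "real CARD('p) > 1" using p_gt_1[where 'p='p] by simp
  then have "real CARD('p) powi (- padic_val x) \<le> real CARD('p) powi (- m) \<longleftrightarrow> m \<le> padic_val x"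
    using power_int_strict_increasing[of "- m" "- padic_val x" "real CARD('p)"]
      power_int_increasing[of "- padic_val x" "- m" "real CARD('p)"] by (cases "m \<le> padic_val x") auto
  with False show ?thesis by (simp add: padic_norm_def padic_val_iff)
qed

lemma padic_norm_le_1_iff: "padic_norm x \<le> 1 \<longleftrightarrow> x \<in> Zp"
  using padic_norm_le_iff[of x 0] by simp

lemma padic_norm_nonneg [simp]: "padic_norm x \<ge> 0"
  by (simp add: padic_norm_def)

lemma padic_norm_eq_0_iff [simp]: "padic_norm (x :: 'p::prime_card padic) = 0 \<longleftrightarrow> x = 0"
  using p_gt_1[where 'p='p] by (simp add: padic_norm_def power_int_eq_0_iff)

lemma powi_Zp_add:
  assumes "a \<in> (*) c ` Zp" "b \<in> (*) c ` Zp"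
  shows "a + b \<in> (*) c ` Zp"
proof -
  obtain x y where "a = c * x" "x \<in> Zp" "b = c * y" "y \<in> Zp" using assms by blast
  then show ?thesis by (intro image_eqI[of _ _ "x + y"]) (simp_all add: distrib_left Zp_add)
qed

lemma powi_Zp_uminus:
  assumes "a \<in> (*) c ` Zp"
  shows "- a \<in> (*) c ` Zp"
proof -
  obtain x where "a = c * x" "x \<in> Zp" using assms by blast
  then show ?thesis by (intro image_eqI[of _ _ "- x"]) (simp_all add: Zp_uminus)
qed

lemma padic_norm_add: "padic_norm (x + y :: 'p::prime_card padic) \<le> max (padic_norm x) (padic_norm y)"
proof -
  have *: "padic_norm (x + y) \<le> padic_norm x" if "padic_norm y \<le> padic_norm x" "x \<noteq> 0" for x y :: "'p padic"
  proof -
    have "padic_norm x \<le> real CARD('p) powi (- padic_val x)" using that by (simp add: padic_norm_def)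
    moreover from this have "padic_norm y \<le> real CARD('p) powi (- padic_val x)" using that by linarith
    ultimately have "padic_norm (x + y) \<le> real CARD('p) powi (- padic_val x)"
      unfolding padic_norm_le_iff by (rule powi_Zp_add)
    then show ?thesis using that by (simp add: padic_norm_def)
  qed
  consider "x = 0" | "y = 0" | "x \<noteq> 0" "y \<noteq> 0" by blast
  then show ?thesis
  proof cases
    case 3
    then show ?thesis using *[of y x] *[of x y] by (cases "padic_norm y \<le> padic_norm x") (auto simp: add.commute)
  qed auto
qed

lemma padic_norm_uminus: "padic_norm (- x :: 'p::prime_card padic) = padic_norm x"
proof -
  have *: "padic_norm (- x) \<le> padic_norm x" for x :: "'p padic"
  proof (cases "x = 0")
    case False
    have "padic_norm x \<le> real CARD('p) powi (- padic_val x)" using False by (simp add: padic_norm_def)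
    then have "padic_norm (- x) \<le> real CARD('p) powi (- padic_val x)"
      unfolding padic_norm_le_iff by (rule powi_Zp_uminus)
    then show ?thesis using False by (simp add: padic_norm_def)
  qed simp
  from *[of x] *[of "- x"] show ?thesis by simp
qed

instantiation padic :: (prime_card) metric_space
begin

definition dist_padic :: "'a padic \<Rightarrow> 'a padic \<Rightarrow> real" where
  "dist_padic x y = padic_norm (x - y)"

definition uniformity_padic :: "('a padic \<times> 'a padic) filter" where
  "uniformity_padic = (INF e\<in>{0<..}. principal {(x, y). dist x y < e})"

definition open_padic :: "'a padic set \<Rightarrow> bool" where
  "open_padic U \<longleftrightarrow> (\<forall>x\<in>U. eventually (\<lambda>(x', y). x' = x \<longrightarrow> y \<in> U) uniformity)"

instance
proof
  fix x y z :: "'a padic"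
  show "dist x y = 0 \<longleftrightarrow> x = y" by (simp add: dist_padic_def)
  have "padic_norm ((x - z) + - (y - z)) \<le> max (padic_norm (x - z)) (padic_norm (y - z))"
    using padic_norm_add[of "x - z" "- (y - z)"] by (simp only: padic_norm_uminus)
  also have "\<dots> \<le> padic_norm (x - z) + padic_norm (y - z)" by simp
  finally show "dist x y \<le> dist x z + dist y z" by (simp add: dist_padic_def)
qed (simp_all add: uniformity_padic_def open_padic_def)

end

section \<open>Expansions, fractional parts and the dual of $\mathbb{Z}_p$\<close>

definition padic_expansion :: "'p::prime_card padic \<Rightarrow> int \<Rightarrow> (int \<Rightarrow> nat) \<Rightarrow> bool" where
  "padic_expansion u i c \<longleftrightarrow> (\<forall>k. c k < CARD('p)) \<and>
    (\<lambda>n. of_nat (c (i + int n)) * of_nat CARD('p) powi (i + int n)) sums u"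

text \<open>The interval \<^term>\<open>{i..-1}\<close> is empty for $i \ge 0$; the value does not depend on $i$ and $c$,
  see \<open>padic_expansion_exists\<close> and \<open>padic_frac_eq\<close> below.\<close>

definition padic_frac :: "'p::prime_card padic \<Rightarrow> real" where
  "padic_frac u = (THE t. \<exists>i c. padic_expansion u i c \<and>
    t = (\<Sum>k = i..-1. real (c k) * real CARD('p) powi k))"

text \<open>Representatives of $\mathbb{Q}_p/\mathbb{Z}_p$: the trivial class is represented by $1$.\<close>

definition Zp_dual :: "'p::prime_card padic set" where
  "Zp_dual = insert 1 {\<Sum>k | 1 \<le> k \<and> l k \<noteq> 0. of_nat (l k) * of_nat CARD('p) powi (- int k) | l :: nat \<Rightarrow> nat.
    (\<forall>k. l k < CARD('p)) \<and> finite {k. 1 \<le> k \<and> l k \<noteq> 0} \<and> {k. 1 \<le> k \<and> l k \<noteq> 0} \<noteq> {}}"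

lemma digit_sum_less:
  fixes c :: "nat \<Rightarrow> nat"
  assumes "\<And>j. c j < q"
  shows "(\<Sum>j<n. c j * q ^ j) < q ^ n"
proof (induction n)
  case (Suc n)
  have "(\<Sum>j<Suc n. c j * q ^ j) < q ^ n + c n * q ^ n" using Suc by simp
  also have "\<dots> = Suc (c n) * q ^ n" by simp
  also have "\<dots> \<le> q * q ^ n" using assms[of n] by (intro mult_right_mono) auto
  finally show ?case by simp
qed simp

text \<open>$\mathbb{Z}[1/p] \cap [0,1)$ meets every class modulo $\mathbb{Z}_p$ at most once.\<close>

lemma frac_unique_aux:
  fixes u :: "'p::prime_card padic"
  assumes "A < CARD('p) ^ N" "B < CARD('p) ^ M"
    and "of_nat A / of_nat CARD('p) ^ N - of_nat B / of_nat CARD('p) ^ M \<in> (Zp :: 'p padic set)"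
  shows "real A / real CARD('p) ^ N = real B / real CARD('p) ^ M"
proof -
  define w :: "'p padic" where "w = of_nat A / of_nat CARD('p) ^ N - of_nat B / of_nat CARD('p) ^ M"
  have "of_nat (A * CARD('p) ^ M) - of_nat (B * CARD('p) ^ N) = of_nat CARD('p) ^ (N + M) * w"
    by (simp add: w_def power_add field_simps)
  moreover have "w \<in> Zp" using assms(3) by (simp add: w_def)
  ultimately have "A * CARD('p) ^ M mod CARD('p) ^ (N + M) = B * CARD('p) ^ N mod CARD('p) ^ (N + M)"
    by (rule of_nat_diff_Zp)
  moreover have p0: "CARD('p) > 0" using p_gt_1[where 'p='p] by simp
  have "A * CARD('p) ^ M < CARD('p) ^ (N + M)" "B * CARD('p) ^ N < CARD('p) ^ (N + M)"
    using assms(1,2) p0 by (simp_all add: power_add)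
  ultimately have "A * CARD('p) ^ M = B * CARD('p) ^ N" by simp
  then have "real A * real CARD('p) ^ M = real B * real CARD('p) ^ N"
    by (metis of_nat_mult of_nat_power)
  then show ?thesis using p0 by (simp add: field_simps)
qed

lemma sum_int_shift:
  fixes f :: "int \<Rightarrow> 'b::comm_monoid_add"
  shows "(\<Sum>k = i..-1. f k) = (\<Sum>j<nat (- i). f (i + int j))"
  by (rule sum.reindex_bij_witness[of _ "\<lambda>j. i + int j" "\<lambda>k. nat (k - i)"]) auto

lemma expansion_head:
  fixes c :: "int \<Rightarrow> nat" and q :: "'a::field"
  assumes "q \<noteq> 0"
  shows "(\<Sum>j<nat (- i). of_nat (c (i + int j)) * q powi (i + int j))
    = (\<Sum>j<nat (- i). of_nat (c (i + int j)) * q ^ j) / q ^ nat (- i)"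
  unfolding sum_divide_distrib
proof (rule sum.cong)
  fix j assume "j \<in> {..<nat (- i)}"
  then have "i = - int (nat (- i))" by simp
  then have "q powi (i + int j) = q ^ j / q ^ nat (- i)"
    using assms by (metis add.commute diff_conv_add_uminus power_int_diff power_int_of_nat)
  then show "of_nat (c (i + int j)) * q powi (i + int j) = of_nat (c (i + int j)) * q ^ j / q ^ nat (- i)"
    by simp
qed simp

lemma padic_sums_diff_Zp:
  fixes f :: "nat \<Rightarrow> 'p::prime_card padic"
  assumes "f sums u" "\<And>n. n \<ge> N \<Longrightarrow> f n \<in> Zp"
  shows "u - sum f {..<N} \<in> Zp"
proof -
  have "(\<lambda>n. sum f {..<n}) \<longlonglongrightarrow> u" using assms(1) by (simp add: sums_def)
  then obtain M where M: "\<And>n. n \<ge> M \<Longrightarrow> dist (sum f {..<n}) u < 1"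
    using metric_LIMSEQ_D[of _ u 1] by auto
  define n where "n = max M N"
  have "sum f {..<n} - u \<in> Zp"
    using M[of n] by (simp add: n_def dist_padic_def flip: padic_norm_le_1_iff)
  moreover have "sum f {..<n} = sum f {..<N} + sum f {N..<n}"
    by (simp add: n_def sum.atLeastLessThan_concat flip: atLeast0LessThan)
  moreover have "sum f {N..<n} \<in> Zp" using assms(2) by (intro Zp_sum) auto
  ultimately have "- ((sum f {..<N} + sum f {N..<n}) - u) + sum f {N..<n} \<in> Zp"
    by (metis Zp_add Zp_uminus)
  then show ?thesis by (simp add: algebra_simps)
qed

lemma padic_expansion_diff_Zp:
  fixes u :: "'p::prime_card padic"
  assumes "padic_expansion u i c"
  shows "u - (\<Sum>k = i..-1. of_nat (c k) * of_nat CARD('p) powi k) \<in> Zp"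
  unfolding sum_int_shift
proof (rule padic_sums_diff_Zp)
  show "(\<lambda>n. of_nat (c (i + int n)) * of_nat CARD('p) powi (i + int n)) sums u"
    using assms by (simp add: padic_expansion_def)
  fix n assume "n \<ge> nat (- i)"
  then show "of_nat (c (i + int n)) * of_nat CARD('p) powi (i + int n) \<in> (Zp :: 'p padic set)"
    by (intro Zp_mult Zp_of_nat Zp_powi) simp
qed

lemma padic_frac_eq:
  fixes u :: "'p::prime_card padic"
  assumes "padic_expansion u i c"
  shows "padic_frac u = (\<Sum>k = i..-1. real (c k) * real CARD('p) powi k)"
  unfolding padic_frac_def
proof (rule the_equality)
  have p0: "real CARD('p) \<noteq> 0" using p_gt_1[where 'p='p] by simp
  fix t assume "\<exists>i c. padic_expansion u i c \<and> t = (\<Sum>k = i..-1. real (c k) * real CARD('p) powi k)"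
  then obtain i' c' where e: "padic_expansion u i' c'"
    and t: "t = (\<Sum>k = i'..-1. real (c' k) * real CARD('p) powi k)" by blast
  define h where "h i c = (\<Sum>j<nat (- i). c (i + int j) * CARD('p) ^ j)" for i :: int and c :: "int \<Rightarrow> nat"
  have h: "h i c < CARD('p) ^ nat (- i)" if "padic_expansion u i c" for i c
    using that unfolding h_def by (intro digit_sum_less) (simp add: padic_expansion_def)
  have R: "(\<Sum>k = i..-1. real (c k) * real CARD('p) powi k) = real (h i c) / real CARD('p) ^ nat (- i)" for i c
    unfolding sum_int_shift expansion_head[OF p0] by (simp add: h_def)
  have Q: "(\<Sum>k = i..-1. of_nat (c k) * of_nat CARD('p) powi k) = of_nat (h i c) / (of_nat CARD('p) :: 'p padic) ^ nat (- i)" for i c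
    unfolding sum_int_shift expansion_head[OF of_nat_p_neq_0] by (simp add: h_def)
  have "of_nat (h i' c') / of_nat CARD('p) ^ nat (- i') - of_nat (h i c) / of_nat CARD('p) ^ nat (- i) \<in> (Zp :: 'p padic set)"
    using Zp_diff[OF padic_expansion_diff_Zp[OF assms] padic_expansion_diff_Zp[OF e]]
    unfolding Q by (simp add: algebra_simps)
  from frac_unique_aux[OF h[OF e] h[OF assms] this]
  show "t = (\<Sum>k = i..-1. real (c k) * real CARD('p) powi k)" by (simp only: t R)
qed (use assms in blast)

lemma padic_expansion_exists: "\<exists>i c. padic_expansion (u :: 'p::prime_card padic) i c"
proof -
  let ?p = "int CARD('p)" and ?P = "of_nat CARD('p) :: 'p padic"
  have "\<exists>N w. u = w / ?P ^ N \<and> w \<in> Zp"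
  proof (cases "u = 0")
    case True
    then show ?thesis by (intro exI[of _ 0]) simp
  next
    case False
    then obtain n x v where x: "u = ?P powi n * x" "x \<in> Zp" using padic_decompose by blast
    define m where "m = nat (- n)"
    have "u = (?P powi (n + int m) * x) / ?P ^ m"
      by (simp add: x power_int_add)
    moreover have "?P powi (n + int m) * x \<in> Zp"
      using x by (intro Zp_mult Zp_powi) (auto simp: m_def)
    ultimately show ?thesis by blast
  qed
  then obtain N a where u: "u = padic_of_int a / ?P ^ N" by (auto simp: Zp_def)
  define e where "e j = nat (padic_res a (Suc j) div ?p ^ j)" for j
  have e: "int (e j) = padic_res a (Suc j) div ?p ^ j" for j
    using padic_res_bounds[of a "Suc j"] by (simp add: e_def pos_imp_zdiv_nonneg_iff p_gt_1)
  have e_less: "e j < CARD('p)" for j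
  proof -
    have pj: "?p ^ j > 0" using p_gt_1[where 'p='p] by simp
    have "padic_res a (Suc j) div ?p ^ j * ?p ^ j \<le> padic_res a (Suc j)"
      using div_mult_mod_eq[of "padic_res a (Suc j)" "?p ^ j"] pos_mod_sign[OF pj, of "padic_res a (Suc j)"]
      by linarith
    also have "\<dots> < ?p * ?p ^ j" using padic_res_bounds(2)[of a "Suc j"] by simp
    finally have "padic_res a (Suc j) div ?p ^ j < ?p" using pj by (simp only: mult_less_cancel_right)
    then show ?thesis using e[of j] by linarith
  qed
  have sum_e: "int (\<Sum>j<n. e j * CARD('p) ^ j) = padic_res a n" for n
  proof (induction n)
    case 0
    then show ?case using padic_res_bounds[of a 0] by simp
  next
    case (Suc n)
    have "int (\<Sum>j<Suc n. e j * CARD('p) ^ j) = padic_res a n + (padic_res a (Suc n) div ?p ^ n) * ?p ^ n"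
      using Suc e[of n] by simp
    also have "padic_res a n = padic_res a (Suc n) mod ?p ^ n" by (rule padic_res_mod[symmetric]) simp
    also have "padic_res a (Suc n) mod ?p ^ n + padic_res a (Suc n) div ?p ^ n * ?p ^ n = padic_res a (Suc n)"
      by (rule mod_div_mult_eq)
    finally show ?case .
  qed
  define c where "c k = (if k < - int N then 0 else e (nat (k + int N)))" for k
  have partial: "(\<Sum>j<n. of_nat (c (- int N + int j)) * ?P powi (- int N + int j))
      = of_nat (\<Sum>j<n. e j * CARD('p) ^ j) / ?P ^ N" for n
    unfolding of_nat_sum sum_divide_distrib
  proof (rule sum.cong)
    fix j
    have "c (- int N + int j) = e j" by (simp add: c_def)
    moreover have "?P powi (- int N + int j) = ?P ^ j / ?P ^ N"
      using power_int_diff[of ?P "int j" "int N"] by simp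
    ultimately show "of_nat (c (- int N + int j)) * ?P powi (- int N + int j) = of_nat (e j * CARD('p) ^ j) / ?P ^ N"
      by simp
  qed simp
  have lim: "(\<lambda>n. \<Sum>j<n. of_nat (c (- int N + int j)) * ?P powi (- int N + int j)) \<longlonglongrightarrow> u"
  proof (rule metric_LIMSEQ_I)
    fix r :: real assume "r > 0"
    have p1: "real CARD('p) > 1" using p_gt_1[where 'p='p] by simp
    obtain M where M: "real CARD('p) ^ N / r < real CARD('p) ^ M"
      using real_arch_pow[OF p1] by blast
    show "\<exists>no. \<forall>n\<ge>no. dist (\<Sum>j<n. of_nat (c (- int N + int j)) * ?P powi (- int N + int j)) u < r"
    proof (intro exI allI impI)
      fix n assume "n \<ge> M"
      have "padic_res (of_nat (\<Sum>j<n. e j * CARD('p) ^ j) - a) n = 0"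
        using padic_res_bounds[of a n] by (simp only: padic_res_diff padic_res_of_nat sum_e) simp
      then obtain b where "of_nat (\<Sum>j<n. e j * CARD('p) ^ j) - a = of_nat CARD('p) ^ n * b"
        by (metis padic_int_dvd_iff dvdE)
      then have "padic_of_int (of_nat (\<Sum>j<n. e j * CARD('p) ^ j) - a) = padic_of_int (of_nat CARD('p) ^ n * b)"
        by (rule arg_cong)
      then have b: "of_nat (\<Sum>j<n. e j * CARD('p) ^ j) - padic_of_int a = ?P ^ n * padic_of_int b"
        by (simp only: padic_of_int_diff padic_of_int_mult padic_of_int_power padic_of_int_of_nat)
      have "of_nat (\<Sum>j<n. e j * CARD('p) ^ j) / ?P ^ N - u = ?P powi (int n - int N) * padic_of_int b"
        unfolding u diff_divide_distrib[symmetric] b by (simp add: power_int_diff)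
      then have "of_nat (\<Sum>j<n. e j * CARD('p) ^ j) / ?P ^ N - u \<in> (*) (?P powi (int n - int N)) ` Zp"
        by (auto simp: Zp_def)
      then have "dist (of_nat (\<Sum>j<n. e j * CARD('p) ^ j) / ?P ^ N) u \<le> real CARD('p) powi (- (int n - int N))"
        unfolding dist_padic_def padic_norm_le_iff .
      also have "\<dots> = real CARD('p) ^ N / real CARD('p) ^ n"
        using p1 by (simp add: power_int_diff)
      also have "\<dots> \<le> real CARD('p) ^ N / real CARD('p) ^ M"
        using p1 \<open>n \<ge> M\<close> by (intro divide_left_mono power_increasing) auto
      also have "\<dots> < r" using M \<open>r > 0\<close> p1 by (simp add: field_simps)
      finally show "dist (\<Sum>j<n. of_nat (c (- int N + int j)) * ?P powi (- int N + int j)) u < r"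
        unfolding partial .
    qed
  qed
  have "padic_expansion u (- int N) c"
    unfolding padic_expansion_def sums_def
  proof (intro conjI allI lim)
    show "c k < CARD('p)" for k using e_less p_gt_1[where 'p='p] by (simp add: c_def)
  qed
  then show ?thesis by blast
qed

lemma Zp_dual_norm_ge_1:
  assumes "\<gamma> \<in> Zp_dual"
  shows "padic_norm (\<gamma> :: 'p::prime_card padic) \<ge> 1"
proof (rule ccontr)
  assume "\<not> padic_norm \<gamma> \<ge> 1"
  then have less: "padic_norm \<gamma> < 1" by simp
  then have Z: "\<gamma> \<in> Zp" by (simp flip: padic_norm_le_1_iff)
  have "(1 :: 'p padic) = of_nat CARD('p) powi 0 * 1" by simp
  from powi_Zp_iff[OF this] have "1 \<in> (*) (of_nat CARD('p) powi 1) ` (Zp :: 'p padic set) \<longleftrightarrow> (1::int) \<le> 0"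
    by (rule meta_mp) auto
  moreover have "1 \<le> padic_norm (1 :: 'p padic)"
  proof (rule ccontr)
    assume "\<not> 1 \<le> padic_norm (1 :: 'p padic)"
    then have "padic_val (1 :: 'p padic) \<ge> 1"
      using one_le_power_int[of "real CARD('p)" "- padic_val (1 :: 'p padic)"] p_gt_1[where 'p='p]
      by (cases "padic_val (1 :: 'p padic) \<ge> 1") (auto simp: padic_norm_def)
    then show False using calculation padic_val_iff[of "1 :: 'p padic" 1] by simp
  qed
  ultimately have "\<gamma> \<noteq> 1" using less by auto
  with assms obtain l where l: "\<And>k. l k < CARD('p)" "finite {k. 1 \<le> k \<and> l k \<noteq> 0}" "{k. 1 \<le> k \<and> l k \<noteq> 0} \<noteq> {}"
    and \<gamma>: "\<gamma> = (\<Sum>k | 1 \<le> k \<and> l k \<noteq> 0. of_nat (l k) * of_nat CARD('p) powi (- int k))"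
    unfolding Zp_dual_def by blast
  let ?K = "{k. 1 \<le> k \<and> l k \<noteq> 0}" and ?P = "of_nat CARD('p) :: 'p padic"
  define N where "N = Max ?K"
  have N: "?K \<subseteq> {1..N}" using l(2) by (auto simp: N_def)
  have "\<gamma> = (\<Sum>k = 1..N. of_nat (l k) * ?P powi (- int k))"
    unfolding \<gamma> using N by (intro sum.mono_neutral_left) auto
  also have "\<dots> = (\<Sum>j<N. of_nat (l (N - j)) * ?P powi (- int (N - j)))"
    by (rule sum.reindex_bij_witness[of _ "\<lambda>j. N - j" "\<lambda>k. N - k"]) auto
  also have "\<dots> = (\<Sum>j<N. of_nat (l (N - j) * CARD('p) ^ j) / ?P ^ N)"
    by (intro sum.cong) (auto simp: of_nat_diff power_int_diff)
  finally have g: "\<gamma> = of_nat (\<Sum>j<N. l (N - j) * CARD('p) ^ j) / ?P ^ N"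
    by (simp add: sum_divide_distrib)
  have A: "(\<Sum>j<N. l (N - j) * CARD('p) ^ j) < CARD('p) ^ N" by (rule digit_sum_less) (rule l(1))
  have p0: "CARD('p) > 0" using p_gt_1[where 'p='p] by simp
  have "real (\<Sum>j<N. l (N - j) * CARD('p) ^ j) / real CARD('p) ^ N = real 0 / real CARD('p) ^ 0"
    by (rule frac_unique_aux[OF A]) (use Z g p0 in simp_all)
  then have "real (\<Sum>j<N. l (N - j) * CARD('p) ^ j) = 0" using p0 by (simp del: of_nat_sum)
  then have 0: "(\<Sum>j<N. l (N - j) * CARD('p) ^ j) = 0" by (simp only: of_nat_eq_0_iff)
  from l(3) obtain k where k: "k \<in> ?K" by blast
  with N have "N - k < N" "N - (N - k) = k" by auto
  moreover have "\<forall>j\<in>{..<N}. l (N - j) * CARD('p) ^ j = 0"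
    using 0 by (simp only: sum_eq_0_iff[OF finite_lessThan])
  ultimately have "l k * CARD('p) ^ (N - k) = 0" by (metis lessThan_iff)
  then have "l k = 0" using p0 by (metis mult_eq_0_iff power_eq_0_iff less_irrefl)
  with k show False by simp
qed

lemma Zp_dual_exists: "\<exists>v\<in>Zp_dual. (u :: 'p::prime_card padic) - v \<in> Zp"
proof -
  obtain i c where e: "padic_expansion u i c" using padic_expansion_exists by blast
  let ?P = "of_nat CARD('p) :: 'p padic"
  define S where "S = (\<Sum>k = i..-1. of_nat (c k) * ?P powi k)"
  have uS: "u - S \<in> Zp" unfolding S_def by (rule padic_expansion_diff_Zp[OF e])
  define l where "l k = (if 1 \<le> k \<and> int k \<le> - i then c (- int k) else 0)" for k :: nat
  let ?K = "{k. 1 \<le> k \<and> l k \<noteq> 0}"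
  have K: "?K \<subseteq> {1..nat (- i)}" by (auto simp: l_def split: if_splits)
  have "S = (\<Sum>k = 1..nat (- i). of_nat (l k) * ?P powi (- int k))"
    unfolding S_def by (rule sum.reindex_bij_witness[of _ "\<lambda>k. - int k" "\<lambda>k. nat (- k)"]) (auto simp: l_def)
  also have "\<dots> = (\<Sum>k | 1 \<le> k \<and> l k \<noteq> 0. of_nat (l k) * ?P powi (- int k))"
    using K by (intro sum.mono_neutral_right) auto
  finally have S: "S = (\<Sum>k | 1 \<le> k \<and> l k \<noteq> 0. of_nat (l k) * ?P powi (- int k))" .
  have l: "\<forall>k. l k < CARD('p)"
    using e p_gt_1[where 'p='p] by (auto simp: l_def padic_expansion_def)
  have fin: "finite ?K" using K by (rule finite_subset) simp
  show ?thesis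
  proof (cases "?K = {}")
    case True
    then have "S = 0" unfolding S by (simp only: sum.empty)
    then have "u - 1 \<in> Zp" using uS Zp_diff[of u 1] by simp
    then show ?thesis by (auto simp: Zp_dual_def)
  next
    case False
    then have "S \<in> Zp_dual" unfolding Zp_dual_def S using l fin by blast
    then show ?thesis using uS by blast
  qed
qed

section \<open>Vectors, lattices and cosets\<close>

definition padic_vnorm :: "('p::prime_card) padic ^ 'd \<Rightarrow> real" where
  "padic_vnorm u = Max (range (\<lambda>i. padic_norm (u $ i)))"

definition vecs :: "'a set \<Rightarrow> ('a ^ 'd) set" where
  "vecs A = {u. \<forall>i. u $ i \<in> A}"

definition cong_rel :: "'a::minus set \<Rightarrow> ('a \<times> 'a) set" where
  "cong_rel L = {(u, v). u - v \<in> L}"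

text \<open>The lattice $s\,\mathbb{Z}_p^d$ for a scalar $s \in \mathbb{Q}_p$.\<close>

definition padic_lattice :: "'p::prime_card padic \<Rightarrow> ('p padic ^ 'd) set" where
  "padic_lattice s = (*s) s ` vecs Zp"

definition padic_proj :: "'p::prime_card padic \<Rightarrow> 'p padic ^ 'd \<Rightarrow> ('p padic ^ 'd) set" where
  "padic_proj \<gamma> x = cong_rel (padic_lattice (padic_abs \<gamma>)) `` {x}"

text \<open>$\mathbb{Z}_p^d / |\gamma|_p \mathbb{Z}_p^d$, whose elements are the cosets themselves.\<close>

definition Zp_quot :: "'p::prime_card padic \<Rightarrow> ('p padic ^ 'd) set set" where
  "Zp_quot \<gamma> = vecs Zp // cong_rel (padic_lattice (padic_abs \<gamma>))"

definition coset_rep :: "'a set \<Rightarrow> 'a" where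
  "coset_rep k = (SOME u. u \<in> k)"

text \<open>The classes $\mathbb{Q}_p^{2d} / |\gamma|_p^{-1} \mathbb{Z}_p^{2d}$, and the systems consisting of one
  representative in $\widehat{\mathbb{Z}_p}^{2d}$ of each class.\<close>

definition Qp_quot :: "'p::prime_card padic \<Rightarrow> (('p padic ^ 'd) \<times> ('p padic ^ 'd)) set set" where
  "Qp_quot \<gamma> = UNIV // cong_rel (padic_lattice (inverse (padic_abs \<gamma>)) \<times> padic_lattice (inverse (padic_abs \<gamma>)))"

definition rep_system :: "'p::prime_card padic \<Rightarrow> (('p padic ^ 'd) \<times> ('p padic ^ 'd)) set \<Rightarrow> bool" where
  "rep_system \<gamma> R \<longleftrightarrow> R \<subseteq> vecs Zp_dual \<times> vecs Zp_dual \<and> (\<forall>C \<in> Qp_quot \<gamma>. \<exists>!v. v \<in> R \<inter> C)"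

lemma equiv_lattice:
  "equiv UNIV (cong_rel (padic_lattice s \<times> padic_lattice s :: (('p::prime_card padic ^ 'd) \<times> ('p padic ^ 'd)) set))"
proof -
  have 0: "0 \<in> (padic_lattice s :: ('p padic ^ 'd) set)"
    unfolding padic_lattice_def by (rule image_eqI[of _ _ 0]) (simp_all add: vecs_def)
  have m: "b - a \<in> padic_lattice s" if ab: "a - b \<in> padic_lattice s" for a b :: "'p padic ^ 'd"
  proof -
    obtain c where c: "a - b = s *s c" "c \<in> vecs Zp" using ab unfolding padic_lattice_def by blast
    have "b - a = - (s *s c)" unfolding c(1)[symmetric] by (rule minus_diff_eq[symmetric])
    also have "\<dots> = s *s (- c)" unfolding vec_eq_iff by simp
    finally have "b - a = s *s (- c)" .
    moreover have "- c \<in> vecs Zp" using c(2) unfolding vecs_def by (simp add: Zp_uminus)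
    ultimately show ?thesis unfolding padic_lattice_def by blast
  qed
  have p: "a - c \<in> padic_lattice s" if ab: "a - b \<in> padic_lattice s" and bc: "b - c \<in> padic_lattice s" for a b c :: "'p padic ^ 'd"
  proof -
    obtain v where v: "a - b = s *s v" "v \<in> vecs Zp" using ab unfolding padic_lattice_def by blast
    obtain w where w: "b - c = s *s w" "w \<in> vecs Zp" using bc unfolding padic_lattice_def by blast
    have "a - c = (a - b) + (b - c)" by simp
    also have "\<dots> = s *s (v + w)" unfolding v(1) w(1) vec_eq_iff by (simp add: distrib_left)
    finally have "a - c = s *s (v + w)" .
    moreover have "v + w \<in> vecs Zp" using v(2) w(2) unfolding vecs_def by (simp add: Zp_add)
    ultimately show ?thesis unfolding padic_lattice_def by blast
  qed
  show ?thesis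
  proof (rule equivI)
    show "refl (cong_rel (padic_lattice s \<times> padic_lattice s :: (('p padic ^ 'd) \<times> ('p padic ^ 'd)) set))"
      using 0 by (auto simp: refl_on_def cong_rel_def zero_prod_def)
    show "sym (cong_rel (padic_lattice s \<times> padic_lattice s :: (('p padic ^ 'd) \<times> ('p padic ^ 'd)) set))"
      by (auto simp: sym_def cong_rel_def intro: m)
    show "trans (cong_rel (padic_lattice s \<times> padic_lattice s :: (('p padic ^ 'd) \<times> ('p padic ^ 'd)) set))"
      by (auto simp: trans_def cong_rel_def intro: p)
  qed auto
qed

lemma rep_system_exists:
  assumes "\<gamma> \<in> Zp_dual"
  shows "\<exists>R :: (('p padic ^ 'd) \<times> ('p::prime_card padic ^ 'd)) set. rep_system \<gamma> R"
proof -
  let ?D = "vecs Zp_dual \<times> vecs Zp_dual :: (('p padic ^ 'd) \<times> ('p padic ^ 'd)) set"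
  let ?s = "inverse (padic_abs \<gamma>)"
  let ?r = "cong_rel (padic_lattice ?s \<times> padic_lattice ?s :: (('p padic ^ 'd) \<times> ('p padic ^ 'd)) set)"
  have n0: "\<gamma> \<noteq> 0" using Zp_dual_norm_ge_1[OF assms] by (auto simp: padic_norm_def)
  have val: "padic_val \<gamma> \<le> 0"
  proof (rule ccontr)
    assume "\<not> padic_val \<gamma> \<le> 0"
    then have "real CARD('p) powi (- padic_val \<gamma>) < real CARD('p) powi 0"
      using p_gt_1[where 'p='p] by (intro power_int_strict_increasing) auto
    then show False using Zp_dual_norm_ge_1[OF assms] n0 by (simp add: padic_norm_def)
  qed
  have sub: "a \<in> padic_lattice ?s" if "a \<in> vecs Zp" for a :: "'p padic ^ 'd"
  proof -
    have abs: "padic_abs \<gamma> = of_nat CARD('p) powi (- padic_val \<gamma>)" using n0 by (simp add: padic_abs_def)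
    then have "padic_abs \<gamma> \<in> Zp" using val by (simp only: abs) (intro Zp_powi, simp)
    then have "padic_abs \<gamma> *s a \<in> vecs Zp" using that by (simp add: vecs_def Zp_mult)
    moreover have "padic_abs \<gamma> \<noteq> 0" by (simp add: abs)
    then have "a = ?s *s (padic_abs \<gamma> *s a)" by (simp add: vec_eq_iff)
    ultimately show ?thesis unfolding padic_lattice_def by blast
  qed
  have near: "\<exists>v \<in> vecs Zp_dual. u - v \<in> padic_lattice ?s" for u :: "'p padic ^ 'd"
  proof -
    have "\<forall>i. \<exists>v. v \<in> Zp_dual \<and> u $ i - v \<in> Zp" using Zp_dual_exists by blast
    from choice[OF this] obtain f where f: "\<And>i. f i \<in> Zp_dual \<and> u $ i - f i \<in> Zp" by blast
    then have "(\<chi> i. f i) \<in> vecs Zp_dual" "u - (\<chi> i. f i) \<in> vecs Zp" by (auto simp: vecs_def)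
    then show ?thesis using sub by blast
  qed
  have "\<exists>v. v \<in> ?D \<inter> C" if C: "C \<in> Qp_quot \<gamma>" for C :: "(('p padic ^ 'd) \<times> ('p padic ^ 'd)) set"
  proof -
    obtain ab where "C = ?r `` {ab}" using C unfolding Qp_quot_def by (rule quotientE)
    then obtain a b where "C = ?r `` {(a, b)}" by (cases ab) blast
    moreover obtain v w where "v \<in> vecs Zp_dual" "w \<in> vecs Zp_dual" "a - v \<in> padic_lattice ?s" "b - w \<in> padic_lattice ?s"
      using near by metis
    ultimately have "(v, w) \<in> ?D \<inter> C" by (auto simp: cong_rel_def)
    then show ?thesis by blast
  qed
  then obtain g where g: "\<And>C. C \<in> Qp_quot \<gamma> \<Longrightarrow> g C \<in> ?D \<inter> C" by metis
  have disj: "C = C'" if "C \<in> Qp_quot \<gamma>" "C' \<in> Qp_quot \<gamma>" "v \<in> C" "v \<in> C'" for C C' and v :: "('p padic ^ 'd) \<times> ('p padic ^ 'd)"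
    using that quotient_disj[OF equiv_lattice] unfolding Qp_quot_def by blast
  have "rep_system \<gamma> (g ` Qp_quot \<gamma>)"
    unfolding rep_system_def
  proof (intro conjI ballI)
    fix C :: "(('p padic ^ 'd) \<times> ('p padic ^ 'd)) set" assume C: "C \<in> Qp_quot \<gamma>"
    show "\<exists>!v. v \<in> g ` Qp_quot \<gamma> \<inter> C"
    proof (rule ex1I[of _ "g C"])
      fix v assume "v \<in> g ` Qp_quot \<gamma> \<inter> C"
      then obtain C' where C': "C' \<in> Qp_quot \<gamma>" "v = g C'" "v \<in> C" by blast
      then have "C' = C" using disj g C by blast
      then show "v = g C" using C' by simp
    qed (use g C in blast)
  qed (use g in blast)
  then show ?thesis by blast
qed

section \<open>The Heisenberg group and its matrix coefficients\<close>

text \<open>Rows and columns of a $(d+2) \times (d+2)$ matrix are indexed by \<^typ>\<open>unit + 'd + unit\<close>.\<close>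

type_synonym ('a, 'd) heis_matrix = "'a ^ (unit + 'd + unit) ^ (unit + 'd + unit)"

fun heis_entry :: "'a::zero_neq_one ^ 'd \<Rightarrow> 'a ^ 'd \<Rightarrow> 'a \<Rightarrow> unit + 'd + unit \<Rightarrow> unit + 'd + unit \<Rightarrow> 'a" where
  "heis_entry x y z (Inl _) (Inl _) = 1"
| "heis_entry x y z (Inl _) (Inr (Inl j)) = x $ j"
| "heis_entry x y z (Inl _) (Inr (Inr _)) = z"
| "heis_entry x y z (Inr (Inl i)) (Inl _) = 0"
| "heis_entry x y z (Inr (Inl i)) (Inr (Inl j)) = (if i = j then 1 else 0)"
| "heis_entry x y z (Inr (Inl i)) (Inr (Inr _)) = y $ i"
| "heis_entry x y z (Inr (Inr _)) (Inl _) = 0"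
| "heis_entry x y z (Inr (Inr _)) (Inr (Inl j)) = 0"
| "heis_entry x y z (Inr (Inr _)) (Inr (Inr _)) = 1"

definition heis :: "'a::zero_neq_one ^ 'd \<Rightarrow> 'a ^ 'd \<Rightarrow> 'a \<Rightarrow> ('a, 'd::finite) heis_matrix" where
  "heis x y z = (\<chi> i j. heis_entry x y z i j)"

definition heis_group :: "'a::zero_neq_one set \<Rightarrow> ('a, 'd::finite) heis_matrix set" where
  "heis_group A = {heis x y z | x y z. x \<in> vecs A \<and> y \<in> vecs A \<and> z \<in> A}"

definition heis_a :: "('a, 'd::finite) heis_matrix \<Rightarrow> 'a ^ 'd" where
  "heis_a g = (\<chi> j. g $ Inl () $ Inr (Inl j))"

definition heis_b :: "('a, 'd::finite) heis_matrix \<Rightarrow> 'a ^ 'd" where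
  "heis_b g = (\<chi> i. g $ Inr (Inl i) $ Inr (Inr ()))"

definition heis_c :: "('a, 'd::finite) heis_matrix \<Rightarrow> 'a" where
  "heis_c g = g $ Inl () $ Inr (Inr ())"

lemma heis_coords [simp]: "heis_a (heis x y z) = x" "heis_b (heis x y z) = y" "heis_c (heis x y z) = z"
  by (simp_all add: heis_a_def heis_b_def heis_c_def heis_def vec_eq_iff)

text \<open>The factor $e^{2\pi i\{\gamma k' b\}_p}$ does not depend on the choice of the element
  \<^term>\<open>coset_rep k'\<close> of the coset $k'$.  The set $\{u - v \mid u \in k, v \in k'\}$ is the coset $k - k'$;
  the minus sign on sets is taken by set difference.\<close>

definition chi_coeff :: "'p::prime_card padic ^ 'd \<Rightarrow> 'p padic ^ 'd \<Rightarrow> 'p padic \<Rightarrow>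
    ('p padic ^ 'd) set \<Rightarrow> ('p padic ^ 'd) set \<Rightarrow> ('p padic, 'd) heis_matrix \<Rightarrow> complex" where
  "chi_coeff \<alpha> \<beta> \<gamma> k k' g =
    exp (2 * pi * \<i> * padic_frac (\<gamma> * (heis_c g + scalar_product (coset_rep k') (heis_b g))
      + (scalar_product (heis_a g) \<alpha> + scalar_product (heis_b g) \<beta>)))
    * indicator {u - v | u v. u \<in> k \<and> v \<in> k'} (heis_a g)"

end

theory Submission
  imports Defs
begin

text \<open>
  The function $e(u) = e^{2\pi i\{u\}_p}$ is an additive character of $\mathbb{Q}_p$ with kernel
  $\mathbb{Z}_p$.  Let $g = [a,b,c]$ and $|\gamma|_p = p^m$.  A summand is a constant times
  $\mathbf{1}[a - x \in p^m\mathbb{Z}_p^d]\, e(\gamma(c-z) + (a-x)\alpha + (b-y)\beta)\, e(k\gamma(b-y))$.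
  By orthogonality the sum over $k$ gives $p^{md}\,\mathbf{1}[b-y \in p^m\mathbb{Z}_p^d]$, then the sum over
  $(\alpha,\beta)$ gives $p^{2(r-m)d}\,\mathbf{1}[a-x, b-y \in p^r\mathbb{Z}_p^d]$, and the sum over $\gamma$
  gives $p^r\,\mathbf{1}[c-z \in p^r\mathbb{Z}_p]$.  As $x$ is integral, the three conditions say that
  $g \in [x,y,z] \cdot \mathbb{H}_d(p^r\mathbb{Z}_p)$.
\<close>

section \<open>The scaled lattices\<close>

text \<open>These are the fractional ideals of Q_p. Norm bounds, lattice membership and coset
  conditions are all rewritten as membership in them; negative exponents bound denominators.\<close>

definition pow_Zp :: "int \<Rightarrow> 'p::prime_card padic set" where
  "pow_Zp n = (*) (of_nat CARD('p) powi n) ` Zp"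

lemma pow_Zp_iff: "u \<in> pow_Zp n \<longleftrightarrow> of_nat CARD('p) powi (- n) * u \<in> (Zp :: 'p::prime_card padic set)"
proof
  assume "of_nat CARD('p) powi (- n) * u \<in> (Zp :: 'p padic set)"
  moreover have "u = of_nat CARD('p) powi n * (of_nat CARD('p) powi (- n) * u)"
    by (simp add: power_int_minus)
  ultimately show "u \<in> pow_Zp n" unfolding pow_Zp_def by blast
next
  assume "u \<in> pow_Zp n"
  then obtain w where "w \<in> Zp" "u = of_nat CARD('p) powi n * w" unfolding pow_Zp_def by blast
  then show "of_nat CARD('p) powi (- n) * u \<in> Zp"
    by (simp add: power_int_minus mult.assoc[symmetric])
qed

lemma pow_Zp_0 [simp]: "pow_Zp 0 = Zp"
  by (simp add: pow_Zp_def)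

lemma pow_Zp_mono: "m \<le> n \<Longrightarrow> u \<in> pow_Zp n \<Longrightarrow> u \<in> pow_Zp m"
  unfolding pow_Zp_def using powi_Zp_mono by blast

lemma zero_in_pow_Zp [simp]: "0 \<in> pow_Zp n"
  by (simp add: pow_Zp_iff)

lemma pow_Zp_add: "u \<in> pow_Zp n \<Longrightarrow> v \<in> pow_Zp n \<Longrightarrow> u + v \<in> pow_Zp n"
  unfolding pow_Zp_def by (rule powi_Zp_add)

lemma pow_Zp_uminus: "u \<in> pow_Zp n \<Longrightarrow> - u \<in> pow_Zp n"
  unfolding pow_Zp_def by (rule powi_Zp_uminus)

lemma pow_Zp_diff: "u \<in> pow_Zp n \<Longrightarrow> v \<in> pow_Zp n \<Longrightarrow> u - v \<in> pow_Zp n"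
  using pow_Zp_add[of u n "- v"] pow_Zp_uminus[of v n] by simp

lemma pow_Zp_sum: "(\<And>i. i \<in> I \<Longrightarrow> f i \<in> pow_Zp n) \<Longrightarrow> sum f I \<in> pow_Zp n"
  by (induction I rule: infinite_finite_induct) (simp_all add: pow_Zp_add)

lemma pow_Zp_mult:
  assumes "u \<in> pow_Zp m" "v \<in> pow_Zp n"
  shows "u * v \<in> pow_Zp (m + n)"
proof -
  obtain u' v' where "u = of_nat CARD('a) powi m * u'" "u' \<in> Zp" "v = of_nat CARD('a) powi n * v'" "v' \<in> Zp"
    using assms unfolding pow_Zp_def by blast
  then show ?thesis
    unfolding pow_Zp_def by (intro image_eqI[of _ _ "u' * v'"]) (simp_all add: power_int_add Zp_mult ac_simps)
qed

lemma powi_mult_in_pow_Zp_iff: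
  "of_nat CARD('p) powi m * u \<in> pow_Zp (m + n) \<longleftrightarrow> (u :: 'p::prime_card padic) \<in> pow_Zp n"
  unfolding pow_Zp_iff by (simp add: mult.assoc[symmetric] flip: power_int_add)

lemma powi_mult_of_nat_in_pow_Zp: "of_nat CARD('p) powi a * of_nat j \<in> (pow_Zp a :: 'p::prime_card padic set)"
  unfolding pow_Zp_def by (intro imageI Zp_of_nat)

lemma padic_norm_le_power_iff:
  "padic_norm u \<le> real CARD('p) ^ r \<longleftrightarrow> (u :: 'p::prime_card padic) \<in> pow_Zp (- int r)"
  using padic_norm_le_iff[of u "- int r"] by (simp add: pow_Zp_def)

lemma padic_vnorm_le_power_iff:
  fixes u :: "'p::prime_card padic ^ 'd"
  shows "padic_vnorm u \<le> real CARD('p) ^ r \<longleftrightarrow> (\<forall>i. u $ i \<in> pow_Zp (- int r))"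
  unfolding padic_vnorm_def by (subst Max_le_iff) (auto simp: padic_norm_le_power_iff)

lemma padic_lattice_iff:
  fixes u :: "'p::prime_card padic ^ 'd"
  shows "u \<in> padic_lattice (of_nat CARD('p) powi n) \<longleftrightarrow> (\<forall>i. u $ i \<in> pow_Zp n)"
proof
  assume *: "\<forall>i. u $ i \<in> pow_Zp n"
  let ?v = "of_nat CARD('p) powi (- n) *s u"
  have "?v \<in> vecs Zp" using * by (simp add: vecs_def pow_Zp_iff)
  moreover have "u = of_nat CARD('p) powi n *s ?v" by (simp add: vec_eq_iff power_int_minus)
  ultimately show "u \<in> padic_lattice (of_nat CARD('p) powi n)" unfolding padic_lattice_def by blast
qed (auto simp: padic_lattice_def vecs_def pow_Zp_def)

lemma scalar_product_in_Zp:
  assumes "\<And>i. u $ i * v $ i \<in> Zp"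
  shows "scalar_product u v \<in> Zp"
  unfolding scalar_product_def using assms by (intro Zp_sum)

section \<open>Digit representatives of p^a Z_p modulo p^(a+n) Z_p\<close>

text \<open>Writing u = p^a w with w integral, the witness is the residue of \<open>w\<close> modulo
  p^n.\<close>

lemma powi_Zp_digit_exists:
  fixes u :: "'p::prime_card padic"
  assumes "u \<in> pow_Zp a"
  shows "\<exists>j<CARD('p) ^ n. u - of_nat CARD('p) powi a * of_nat j \<in> pow_Zp (a + int n)"
proof -
  obtain w where w: "u = of_nat CARD('p) powi a * padic_of_int w"
    using assms by (auto simp: pow_Zp_def Zp_def)
  define j where "j = nat (padic_res w n)"
  have j: "int j = padic_res w n" using padic_res_bounds[of w n] by (simp add: j_def)
  have "int j < int (CARD('p) ^ n)" using padic_res_bounds(2)[of w n] j by simp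
  then have "j < CARD('p) ^ n" by (simp only: of_nat_less_iff)
  moreover have "padic_res (w - of_nat j) n = 0"
    using padic_res_bounds[of w n] by (simp add: padic_res_diff padic_res_of_nat j)
  then obtain v where "w - of_nat j = of_nat CARD('p) ^ n * v"
    by (metis padic_int_dvd_iff dvdE)
  then have "padic_of_int (w - of_nat j) = padic_of_int (of_nat CARD('p) ^ n * v)"
    by (rule arg_cong)
  then have "padic_of_int w - of_nat j = of_nat CARD('p) powi int n * padic_of_int v"
    by (simp add: padic_of_int_diff padic_of_int_mult padic_of_int_power)
  then have "padic_of_int w - of_nat j \<in> pow_Zp (int n)"
    unfolding pow_Zp_def Zp_def by blast
  then have "of_nat CARD('p) powi a * (padic_of_int w - of_nat j) \<in> pow_Zp (a + int n)"
    by (simp only: powi_mult_in_pow_Zp_iff)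
  then have "u - of_nat CARD('p) powi a * of_nat j \<in> pow_Zp (a + int n)"
    by (simp add: w right_diff_distrib)
  ultimately show ?thesis by blast
qed

text \<open>After cancelling p^a, two natural numbers below p^n are congruent modulo p^n.\<close>

lemma powi_Zp_digit_unique:
  assumes "i < CARD('p) ^ n" "j < CARD('p) ^ n"
    and "of_nat CARD('p) powi a * of_nat i - of_nat CARD('p) powi a * of_nat j
      \<in> (pow_Zp (a + int n) :: 'p::prime_card padic set)"
  shows "i = j"
proof -
  have "of_nat i - of_nat j \<in> (pow_Zp (int n) :: 'p padic set)"
    using assms(3) by (simp only: right_diff_distrib[symmetric] powi_mult_in_pow_Zp_iff)
  then obtain w where "of_nat i - of_nat j = of_nat CARD('p) ^ n * (w :: 'p padic)" "w \<in> Zp"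
    by (auto simp: pow_Zp_def)
  from of_nat_diff_Zp[OF this] show ?thesis using assms(1,2) by simp
qed

section \<open>The standard character\<close>

definition padic_char :: "'p::prime_card padic \<Rightarrow> complex" where
  "padic_char u = exp (2 * pi * \<i> * padic_frac u)"

lemma exp_two_pi_i_cong:
  fixes s t :: real
  assumes "s - t \<in> \<int>"
  shows "exp (2 * pi * \<i> * s) = exp (2 * pi * \<i> * t)"
proof -
  obtain n where "s - t = of_int n" using assms by (rule Ints_cases)
  then have "s = t + of_int n" by simp
  then show ?thesis by (auto simp: exp_eq algebra_simps)
qed

text \<open>Collecting the digits at negative positions over a common denominator replaces the
  definite description in \<open>padic_frac\<close> by a concrete fraction. The part left over is
  integral.\<close>

lemma padic_frac_eq_of_nat_divide:
  "\<exists>A N. padic_frac u = real A / real CARD('p) ^ N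
    \<and> u - of_nat A / of_nat CARD('p) ^ N \<in> (Zp :: 'p::prime_card padic set)"
proof -
  have p0: "real CARD('p) \<noteq> 0" using p_gt_1[where 'p='p] by simp
  obtain i c where e: "padic_expansion u i c" using padic_expansion_exists by blast
  define A where "A = (\<Sum>j<nat (- i). c (i + int j) * CARD('p) ^ j)"
  have "padic_frac u = real A / real CARD('p) ^ nat (- i)"
    unfolding padic_frac_eq[OF e] sum_int_shift expansion_head[OF p0] by (simp add: A_def)
  moreover have "u - of_nat A / of_nat CARD('p) ^ nat (- i) \<in> Zp"
    using padic_expansion_diff_Zp[OF e]
    unfolding sum_int_shift expansion_head[OF of_nat_p_neq_0] by (simp add: A_def)
  ultimately show ?thesis by blast
qed

text \<open>Elements of Z[1/p] that are p-adically integral are ordinary integers: clearing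
  denominators gives a congruence modulo p^(N+M) between natural numbers, which reads the same in
  the reals. This carries congruence modulo Z_p over to congruence modulo Z.\<close>

lemma of_nat_frac_diff_Ints:
  assumes "of_nat A / of_nat CARD('p) ^ N - of_nat B / of_nat CARD('p) ^ M \<in> (Zp :: 'p::prime_card padic set)"
  shows "real A / real CARD('p) ^ N - real B / real CARD('p) ^ M \<in> \<int>"
proof -
  define w :: "'p padic" where "w = of_nat A / of_nat CARD('p) ^ N - of_nat B / of_nat CARD('p) ^ M"
  have p0: "real CARD('p) \<noteq> 0" using p_gt_1[where 'p='p] by simp
  have "of_nat (A * CARD('p) ^ M) - of_nat (B * CARD('p) ^ N) = of_nat CARD('p) ^ (N + M) * w"
    by (simp add: w_def power_add field_simps)
  moreover have "w \<in> Zp" using assms by (simp add: w_def)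
  ultimately have "A * CARD('p) ^ M mod CARD('p) ^ (N + M) = B * CARD('p) ^ N mod CARD('p) ^ (N + M)"
    by (rule of_nat_diff_Zp)
  then have "int (A * CARD('p) ^ M) mod int (CARD('p) ^ (N + M)) = int (B * CARD('p) ^ N) mod int (CARD('p) ^ (N + M))"
    by (simp only: flip: of_nat_mod)
  then obtain k where "int (A * CARD('p) ^ M) - int (B * CARD('p) ^ N) = int (CARD('p) ^ (N + M)) * k"
    unfolding mod_eq_dvd_iff by (rule dvdE)
  then have "real_of_int (int (A * CARD('p) ^ M) - int (B * CARD('p) ^ N)) = real_of_int (int (CARD('p) ^ (N + M)) * k)"
    by (rule arg_cong)
  then have "real A * real CARD('p) ^ M - real B * real CARD('p) ^ N = real CARD('p) ^ (N + M) * of_int k"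
    by simp
  then have "real A / real CARD('p) ^ N - real B / real CARD('p) ^ M = of_int k"
    using p0 by (simp add: power_add field_simps)
  then show ?thesis by simp
qed

text \<open>Any fraction A/p^N congruent to \<open>u\<close> may stand in for the fractional part,
  even one outside [0,1). Additivity then needs no discussion of carries.\<close>

lemma padic_char_eq:
  assumes "u - of_nat A / of_nat CARD('p) ^ N \<in> (Zp :: 'p::prime_card padic set)"
  shows "padic_char u = exp (2 * pi * \<i> * (real A / real CARD('p) ^ N))"
proof -
  obtain B M where B: "padic_frac u = real B / real CARD('p) ^ M"
    "u - of_nat B / of_nat CARD('p) ^ M \<in> (Zp :: 'p padic set)"
    using padic_frac_eq_of_nat_divide by blast
  have "of_nat B / of_nat CARD('p) ^ M - of_nat A / of_nat CARD('p) ^ N \<in> (Zp :: 'p padic set)"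
    using Zp_diff[OF assms B(2)] by simp
  from exp_two_pi_i_cong[OF of_nat_frac_diff_Ints[OF this]] show ?thesis
    unfolding padic_char_def B(1) by simp
qed

lemma padic_char_add: "padic_char (u + v) = padic_char u * padic_char (v :: 'p::prime_card padic)"
proof -
  have p0: "real CARD('p) \<noteq> 0" using p_gt_1[where 'p='p] by simp
  obtain A N where A: "u - of_nat A / of_nat CARD('p) ^ N \<in> Zp" using padic_frac_eq_of_nat_divide by blast
  obtain B M where B: "v - of_nat B / of_nat CARD('p) ^ M \<in> Zp" using padic_frac_eq_of_nat_divide by blast
  have "u + v - of_nat (A * CARD('p) ^ M + B * CARD('p) ^ N) / of_nat CARD('p) ^ (N + M)
      = (u - of_nat A / of_nat CARD('p) ^ N) + (v - of_nat B / of_nat CARD('p) ^ M)"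
    by (simp add: power_add field_simps)
  then have "u + v - of_nat (A * CARD('p) ^ M + B * CARD('p) ^ N) / of_nat CARD('p) ^ (N + M) \<in> Zp"
    using Zp_add[OF A B] by (simp only:)
  from padic_char_eq[OF this]
  have "padic_char (u + v) = exp (2 * pi * \<i> * (real (A * CARD('p) ^ M + B * CARD('p) ^ N) / real CARD('p) ^ (N + M)))"
    by simp
  also have "real (A * CARD('p) ^ M + B * CARD('p) ^ N) / real CARD('p) ^ (N + M)
      = real A / real CARD('p) ^ N + real B / real CARD('p) ^ M"
    using p0 by (simp add: power_add field_simps)
  also have "exp (2 * pi * \<i> * complex_of_real \<dots>) = padic_char u * padic_char v"
    unfolding padic_char_eq[OF A] padic_char_eq[OF B] exp_add[symmetric]
    by (simp only: of_real_add distrib_left)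
  finally show ?thesis .
qed

lemma padic_char_Zp: "u \<in> Zp \<Longrightarrow> padic_char u = 1"
  using padic_char_eq[of u 0 0] by simp

text \<open>If the exponential is 1, then A/p^N is an integer, so p^N divides \<open>A\<close> and
  \<open>u\<close> differs from a natural number by an element of Z_p.\<close>

lemma padic_char_eq_1_iff: "padic_char u = 1 \<longleftrightarrow> (u :: 'p::prime_card padic) \<in> Zp"
proof
  have p0: "real CARD('p) \<noteq> 0" using p_gt_1[where 'p='p] by simp
  obtain A N where A: "u - of_nat A / of_nat CARD('p) ^ N \<in> Zp" using padic_frac_eq_of_nat_divide by blast
  assume "padic_char u = 1"
  then have "exp (2 * pi * \<i> * (real A / real CARD('p) ^ N)) = 1" unfolding padic_char_eq[OF A] .
  then obtain n :: int where "2 * pi * (real A / real CARD('p) ^ N) = of_int (2 * n) * pi"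
    unfolding exp_eq_1 by auto
  then have "(2 * pi) * (real A / real CARD('p) ^ N) = (2 * pi) * of_int n"
    by (simp only: of_int_mult of_int_numeral mult.assoc mult.commute[of _ pi])
  then have "real A / real CARD('p) ^ N = of_int n" by (subst (asm) mult_cancel_left) simp
  then have "of_int (int A) = real_of_int (int (CARD('p) ^ N) * n)" using p0 by (simp add: field_simps)
  then have "int A = int (CARD('p) ^ N) * n" by (simp only: of_int_eq_iff)
  then have "int (CARD('p) ^ N) dvd int A" by (rule dvdI)
  then have "CARD('p) ^ N dvd A" by (simp only: of_nat_dvd_iff)
  then obtain B where "A = CARD('p) ^ N * B" by (rule dvdE)
  then have "of_nat A / of_nat CARD('p) ^ N = (of_nat B :: 'p padic)" by simp
  with A have "u - of_nat B \<in> Zp" by simp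
  from Zp_add[OF this Zp_of_nat[of B]] show "u \<in> Zp" by simp
qed (rule padic_char_Zp)

lemma padic_char_cong:
  assumes "u - v \<in> Zp"
  shows "padic_char u = padic_char v"
  using padic_char_add[of "u - v" v] padic_char_Zp[OF assms] by simp

lemma padic_char_sum: "padic_char (sum f I) = (\<Prod>i\<in>I. padic_char (f i))"
  by (induction I rule: infinite_finite_induct) (simp_all add: padic_char_add padic_char_Zp)

lemma padic_char_of_nat_mult: "padic_char (of_nat n * u) = padic_char u ^ n"
  by (induction n) (simp_all add: padic_char_Zp padic_char_add distrib_right)

text \<open>The fractional part of -u may differ from the negative of that of \<open>u\<close> by an
  integer, so the sign is moved inside through multiplicativity. This matches the conjugate
  exponential in the theorem.\<close>

lemma padic_char_uminus: "padic_char (- u) = exp (- 2 * pi * \<i> * padic_frac u)"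
proof -
  have "padic_char (- u) * padic_char u = 1"
    by (simp add: padic_char_Zp flip: padic_char_add)
  then have "padic_char (- u) = inverse (padic_char u)" by (metis inverse_unique mult.commute)
  then show ?thesis by (simp add: padic_char_def exp_minus)
qed

section \<open>Orthogonality over digit systems\<close>

text \<open>The sum is geometric with ratio \<open>?c\<close>. The hypothesis on \<open>t\<close>
  makes \<open>?c\<close> a root of unity of order dividing p^n, and by the kernel of the character
  it equals 1 exactly when p^a t is integral.\<close>

lemma sum_padic_char:
  fixes t :: "'p::prime_card padic"
  assumes "t \<in> pow_Zp (- (a + int n))"
  shows "(\<Sum>j<CARD('p) ^ n. padic_char (of_nat CARD('p) powi a * of_nat j * t))
    = (if t \<in> pow_Zp (- a) then of_nat CARD('p) ^ n else 0)"
proof -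
  let ?c = "padic_char (of_nat CARD('p) powi a * t)"
  have eq: "padic_char (of_nat CARD('p) powi a * of_nat j * t) = ?c ^ j" for j
    unfolding padic_char_of_nat_mult[symmetric] by (simp add: ac_simps)
  have "?c = 1 \<longleftrightarrow> t \<in> pow_Zp (- a)"
    using powi_mult_in_pow_Zp_iff[of a t "- a"] by (simp add: padic_char_eq_1_iff)
  moreover have "of_nat CARD('p) powi (a + int n) * t \<in> Zp"
    using assms powi_mult_in_pow_Zp_iff[of "a + int n" t "- (a + int n)"] by simp
  then have "of_nat (CARD('p) ^ n) * (of_nat CARD('p) powi a * t) \<in> Zp"
    by (simp add: power_int_add ac_simps)
  then have "?c ^ (CARD('p) ^ n) = 1"
    unfolding padic_char_of_nat_mult[symmetric] by (rule padic_char_Zp)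
  ultimately show ?thesis unfolding eq sum_gp_strict by simp
qed

text \<open>The coordinates of a digit vector vary independently, so the sum factors into one
  geometric sum per coordinate.\<close>

lemma sum_padic_char_vec:
  fixes t :: "'p::prime_card padic ^ 'd"
  assumes "\<And>i. t $ i \<in> pow_Zp (- (a + int n))"
  shows "(\<Sum>f\<in>UNIV \<rightarrow>\<^sub>E {..<CARD('p) ^ n}.
      padic_char (scalar_product (\<chi> i. of_nat CARD('p) powi a * of_nat (f i)) t))
    = (if \<forall>i. t $ i \<in> pow_Zp (- a) then of_nat CARD('p) ^ (n * CARD('d)) else 0)"
proof -
  have "(\<Sum>f\<in>UNIV \<rightarrow>\<^sub>E {..<CARD('p) ^ n}.
      padic_char (scalar_product (\<chi> i. of_nat CARD('p) powi a * of_nat (f i)) t))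
    = (\<Prod>i\<in>UNIV. \<Sum>j<CARD('p) ^ n. padic_char (of_nat CARD('p) powi a * of_nat j * t $ i))"
    by (simp add: scalar_product_def padic_char_sum prod_sum_PiE)
  also have "\<dots> = (\<Prod>i\<in>UNIV. if t $ i \<in> pow_Zp (- a) then of_nat CARD('p) ^ n else 0)"
    by (intro prod.cong sum_padic_char assms refl)
  also have "\<dots> = (if \<forall>i. t $ i \<in> pow_Zp (- a) then of_nat CARD('p) ^ (n * CARD('d)) else 0)"
    by (auto simp: power_mult)
  finally show ?thesis .
qed

section \<open>Sums over systems of representatives\<close>

text \<open>Each index set of the theorem is compared with a set of digits by "represents the same
  class". Unique partners on both sides determine a bijection, so none has to be written down at
  each use.\<close>

lemma sum_correspondence:
  assumes "\<And>u. u \<in> S \<Longrightarrow> \<exists>!v. v \<in> T \<and> E u v"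
    and "\<And>v. v \<in> T \<Longrightarrow> \<exists>!u. u \<in> S \<and> E u v"
    and "\<And>u v. u \<in> S \<Longrightarrow> v \<in> T \<Longrightarrow> E u v \<Longrightarrow> F u = G v"
  shows "sum F S = sum G T"
proof -
  define i where "i v = (THE u. u \<in> S \<and> E u v)" for v
  define j where "j u = (THE v. v \<in> T \<and> E u v)" for u
  have i: "i v \<in> S" "E (i v) v" if "v \<in> T" for v
    using theI'[OF assms(2)[OF that]] by (simp_all add: i_def)
  have j: "j u \<in> T" "E u (j u)" if "u \<in> S" for u
    using theI'[OF assms(1)[OF that]] by (simp_all add: j_def)
  show ?thesis
  proof (rule sum.reindex_bij_witness[of _ i j])
    fix u assume u: "u \<in> S"
    show "j u \<in> T" "G (j u) = F u" using j[OF u] assms(3)[OF u] by auto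
    show "i (j u) = u" using assms(2)[OF j(1)[OF u]] i[OF j(1)[OF u]] j[OF u] u by blast
  next
    fix v assume v: "v \<in> T"
    show "i v \<in> S" using i[OF v] by blast
    show "j (i v) = v" using assms(1)[OF i(1)[OF v]] j[OF i(1)[OF v]] i[OF v] v by blast
  qed
qed

lemma powi_Zp_digit_ex1:
  fixes u :: "'p::prime_card padic"
  assumes "u \<in> pow_Zp a"
  shows "\<exists>!j. j \<in> {..<CARD('p) ^ n} \<and> u - of_nat CARD('p) powi a * of_nat j \<in> pow_Zp (a + int n)"
proof (rule ex_ex1I)
  show "\<exists>j. j \<in> {..<CARD('p) ^ n} \<and> u - of_nat CARD('p) powi a * of_nat j \<in> pow_Zp (a + int n)"
    using powi_Zp_digit_exists[OF assms] by auto
next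
  fix i j
  assume i: "i \<in> {..<CARD('p) ^ n} \<and> u - of_nat CARD('p) powi a * of_nat i \<in> pow_Zp (a + int n)"
    and j: "j \<in> {..<CARD('p) ^ n} \<and> u - of_nat CARD('p) powi a * of_nat j \<in> pow_Zp (a + int n)"
  have "of_nat CARD('p) powi a * of_nat i - of_nat CARD('p) powi a * of_nat j \<in> (pow_Zp (a + int n) :: 'p padic set)"
    using pow_Zp_diff[OF conjunct2[OF j] conjunct2[OF i]] by simp
  then show "i = j" using i j by (intro powi_Zp_digit_unique[where 'p='p and n=n and a=a]) simp_all
qed

lemma vec_digit_ex1:
  fixes u :: "'p::prime_card padic ^ 'd"
  assumes "\<And>i. u $ i \<in> pow_Zp a"
  shows "\<exists>!f. f \<in> UNIV \<rightarrow>\<^sub>E {..<CARD('p) ^ n} \<and>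
    (\<forall>i. u $ i - of_nat CARD('p) powi a * of_nat (f i) \<in> pow_Zp (a + int n))"
proof -
  let ?P = "\<lambda>i j. j \<in> {..<CARD('p) ^ n} \<and> u $ i - of_nat CARD('p) powi a * of_nat j \<in> pow_Zp (a + int n)"
  have "\<And>i. \<exists>!j. ?P i j" using assms by (rule powi_Zp_digit_ex1)
  then obtain g where g: "\<And>i. ?P i (g i)" "\<And>i j. ?P i j \<Longrightarrow> j = g i" by metis
  show ?thesis
  proof (rule ex1I[of _ g])
    show "g \<in> UNIV \<rightarrow>\<^sub>E {..<CARD('p) ^ n} \<and>
        (\<forall>i. u $ i - of_nat CARD('p) powi a * of_nat (g i) \<in> pow_Zp (a + int n))"
      using g(1) by (simp add: PiE_UNIV_domain)
  next
    fix f assume f: "f \<in> UNIV \<rightarrow>\<^sub>E {..<CARD('p) ^ n} \<and>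
        (\<forall>i. u $ i - of_nat CARD('p) powi a * of_nat (f i) \<in> pow_Zp (a + int n))"
    have "f i = g i" for i using f by (intro g(2)) (auto simp: PiE_UNIV_domain)
    then show "f = g" by (rule ext)
  qed
qed

section \<open>The representatives of Q_p/Z_p\<close>

text \<open>The finitely many digits are put over a common denominator p^N, where \<open>N\<close>
  bounds their positions. The numerator is nonzero because representatives have norm at least
  1.\<close>

lemma Zp_dual_cases:
  assumes "\<gamma> \<in> Zp_dual" "\<gamma> \<noteq> 1"
  shows "\<exists>A N. 0 < A \<and> A < CARD('p) ^ N \<and> (\<gamma> :: 'p::prime_card padic) = of_nat A / of_nat CARD('p) ^ N"
proof -
  let ?P = "of_nat CARD('p) :: 'p padic"
  from assms obtain l where l: "\<And>k. l k < CARD('p)" "finite {k. 1 \<le> k \<and> l k \<noteq> 0}"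
    and \<gamma>: "\<gamma> = (\<Sum>k | 1 \<le> k \<and> l k \<noteq> 0. of_nat (l k) * ?P powi (- int k))"
    unfolding Zp_dual_def by blast
  obtain N where N: "{k. 1 \<le> k \<and> l k \<noteq> 0} \<subseteq> {..N}"
    using l(2) finite_nat_iff_bounded_le by blast
  define A where "A = (\<Sum>j<N. l (N - j) * CARD('p) ^ j)"
  have "\<gamma> = (\<Sum>k = 1..N. of_nat (l k) * ?P powi (- int k))"
    unfolding \<gamma> using N by (intro sum.mono_neutral_left) auto
  \<comment> \<open>Reversing the digits by k = N - j makes the numerator an ordinary base p
    expansion.\<close>
  also have "\<dots> = (\<Sum>j<N. of_nat (l (N - j)) * ?P powi (- int (N - j)))"
    by (rule sum.reindex_bij_witness[of _ "\<lambda>j. N - j" "\<lambda>k. N - k"]) auto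
  also have "\<dots> = (\<Sum>j<N. of_nat (l (N - j) * CARD('p) ^ j) / ?P ^ N)"
    by (intro sum.cong) (auto simp: power_int_diff)
  also have "\<dots> = of_nat A / ?P ^ N" by (simp add: A_def sum_divide_distrib)
  finally have \<gamma>: "\<gamma> = of_nat A / ?P ^ N" .
  have "A < CARD('p) ^ N" unfolding A_def by (rule digit_sum_less) (rule l(1))
  moreover have "A \<noteq> 0" using Zp_dual_norm_ge_1[OF assms(1)] \<gamma> by (intro notI) (simp add: padic_norm_def)
  ultimately show ?thesis using \<gamma> by blast
qed

text \<open>Apart from 1, representatives are fractions in Z[1/p] strictly between 0 and 1, and two
  such fractions congruent modulo Z_p coincide. The representative 1 is treated separately.\<close>

lemma Zp_dual_unique:
  assumes "\<gamma> \<in> Zp_dual" "\<delta> \<in> Zp_dual" "\<gamma> - \<delta> \<in> (Zp :: 'p::prime_card padic set)"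
  shows "\<gamma> = \<delta>"
proof -
  have p0: "real CARD('p) \<noteq> 0" using p_gt_1[where 'p='p] by simp
  \<comment> \<open>An integral representative must be 1: any other one would be a fraction with
    positive numerator that is congruent to 0, contradicting uniqueness in [0,1).\<close>
  have not_1: "\<delta> = 1" if d: "\<delta> \<in> Zp_dual" "\<delta> \<in> Zp" for \<delta> :: "'p padic"
  proof (rule ccontr)
    assume "\<delta> \<noteq> 1"
    then obtain A N where A: "0 < A" "A < CARD('p) ^ N" "\<delta> = of_nat A / of_nat CARD('p) ^ N"
      using Zp_dual_cases d by blast
    have "real A / real CARD('p) ^ N = real 0 / real CARD('p) ^ 0"
      by (rule frac_unique_aux[where 'p='p]) (use A d in simp_all)
    then show False using A p0 by simp
  qed
  show ?thesis
  proof (cases "\<gamma> = 1 \<or> \<delta> = 1")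
    case True
    then have "\<gamma> \<in> Zp" "\<delta> \<in> Zp"
      using Zp_add[OF assms(3), of \<delta>] Zp_diff[OF _ assms(3), of \<gamma>] by auto
    then show ?thesis using not_1 assms by metis
  next
    case False
    then obtain A N B M where A: "A < CARD('p) ^ N" "\<gamma> = of_nat A / of_nat CARD('p) ^ N"
      and B: "B < CARD('p) ^ M" "\<delta> = of_nat B / of_nat CARD('p) ^ M"
      using Zp_dual_cases assms by metis
    have "real A / real CARD('p) ^ N = real B / real CARD('p) ^ M"
      using frac_unique_aux[OF A(1) B(1)] assms(3) A(2) B(2) by simp
    then have "real (A * CARD('p) ^ M) = real (B * CARD('p) ^ N)" using p0 by (simp add: field_simps)
    then have "A * CARD('p) ^ M = B * CARD('p) ^ N" by (simp only: of_nat_eq_iff)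
    then have "of_nat (A * CARD('p) ^ M) = (of_nat (B * CARD('p) ^ N) :: 'p padic)" by (rule arg_cong)
    then show ?thesis unfolding A(2) B(2) by (simp add: field_simps)
  qed
qed

text \<open>The representatives summed over stand for the classes of p^(-r) Z_p modulo Z_p, which
  the fractions j/p^r with j < p^r also represent. Since \<open>c\<close> is integral, the character
  depends only on the class of \<gamma>.\<close>

lemma sum_Zp_dual_char:
  fixes c :: "'p::prime_card padic"
  assumes "c \<in> Zp"
  shows "(\<Sum>\<gamma> | \<gamma> \<in> Zp_dual \<and> padic_norm \<gamma> \<le> real CARD('p) ^ r. padic_char (\<gamma> * c))
    = (if c \<in> pow_Zp (int r) then of_nat CARD('p) ^ r else 0)"
proof -
  let ?q = "of_nat CARD('p) powi (- int r) :: 'p padic"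
  have "(\<Sum>\<gamma> | \<gamma> \<in> Zp_dual \<and> padic_norm \<gamma> \<le> real CARD('p) ^ r. padic_char (\<gamma> * c))
    = (\<Sum>j<CARD('p) ^ r. padic_char (?q * of_nat j * c))"
  proof (rule sum_correspondence[where E = "\<lambda>\<gamma> j. \<gamma> - ?q * of_nat j \<in> Zp"])
    fix \<gamma> :: "'p padic" assume "\<gamma> \<in> {\<gamma>. \<gamma> \<in> Zp_dual \<and> padic_norm \<gamma> \<le> real CARD('p) ^ r}"
    then show "\<exists>!j. j \<in> {..<CARD('p) ^ r} \<and> \<gamma> - ?q * of_nat j \<in> Zp"
      using powi_Zp_digit_ex1[of \<gamma> "- int r" r] by (simp add: padic_norm_le_power_iff)
  next
    fix j
    have q: "?q * of_nat j \<in> pow_Zp (- int r)" by (rule powi_mult_of_nat_in_pow_Zp)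
    obtain \<gamma> where \<gamma>: "\<gamma> \<in> Zp_dual" "?q * of_nat j - \<gamma> \<in> Zp" using Zp_dual_exists by blast
    have Z: "\<gamma> - ?q * of_nat j \<in> Zp" using Zp_uminus[OF \<gamma>(2)] by simp
    \<comment> \<open>As r is nonnegative, changing a representative by an element of Z_p preserves
      the norm bound p^r.\<close>
    then have "\<gamma> - ?q * of_nat j \<in> pow_Zp (- int r)" by (auto intro: pow_Zp_mono[of _ 0])
    from pow_Zp_add[OF this q] have "\<gamma> \<in> pow_Zp (- int r)" by simp
    then have "\<gamma> \<in> {\<gamma>. \<gamma> \<in> Zp_dual \<and> padic_norm \<gamma> \<le> real CARD('p) ^ r} \<and> \<gamma> - ?q * of_nat j \<in> Zp"
      using \<gamma> Z by (simp add: padic_norm_le_power_iff)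
    moreover have "\<delta> = \<gamma>" if "\<delta> \<in> Zp_dual" "\<delta> - ?q * of_nat j \<in> Zp" for \<delta>
      using Zp_dual_unique[OF that(1) \<gamma>(1)] Zp_diff[OF that(2) Z] by simp
    ultimately show "\<exists>!\<gamma>. \<gamma> \<in> {\<gamma>. \<gamma> \<in> Zp_dual \<and> padic_norm \<gamma> \<le> real CARD('p) ^ r} \<and> \<gamma> - ?q * of_nat j \<in> Zp"
      by blast
  next
    fix \<gamma> j assume "\<gamma> - ?q * of_nat j \<in> Zp"
    from Zp_mult[OF this assms] show "padic_char (\<gamma> * c) = padic_char (?q * of_nat j * c)"
      by (intro padic_char_cong) (simp add: left_diff_distrib)
  qed
  also have "\<dots> = (if c \<in> pow_Zp (int r) then of_nat CARD('p) ^ r else 0)"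
    using sum_padic_char[of c "- int r" r] assms by simp
  finally show ?thesis .
qed

text \<open>Here \<gamma> is a unit times p^(-m), where m is nonnegative because the norm is at
  least 1. Multiplication by \<gamma> therefore lowers ideal exponents by exactly
  \<open>m\<close>.\<close>

lemma Zp_dual_absE:
  fixes \<gamma> :: "'p::prime_card padic"
  assumes "\<gamma> \<in> Zp_dual" "padic_norm \<gamma> \<le> real CARD('p) ^ r"
  obtains m where "m \<le> r" "padic_norm \<gamma> = real CARD('p) ^ m" "padic_abs \<gamma> = of_nat CARD('p) powi int m"
    "\<And>n t. \<gamma> * t \<in> pow_Zp n \<longleftrightarrow> t \<in> pow_Zp (n + int m)"
proof -
  have p1: "real CARD('p) > 1" using p_gt_1[where 'p='p] by simp
  have "\<gamma> \<noteq> 0" using Zp_dual_norm_ge_1[OF assms(1)] by (auto simp: padic_norm_def)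
  then obtain n u v where u: "\<gamma> = of_nat CARD('p) powi n * u" "u \<in> Zp" "v \<in> Zp" "u * v = 1"
    using padic_decompose by blast
  have val: "padic_val \<gamma> = n"
    using powi_Zp_iff[OF u] padic_val_iff[OF \<open>\<gamma> \<noteq> 0\<close>] by (metis order_antisym order_refl)
  have norm: "padic_norm \<gamma> = real CARD('p) powi (- n)" using \<open>\<gamma> \<noteq> 0\<close> by (simp add: padic_norm_def val)
  have "n \<le> 0"
  proof (rule ccontr)
    assume "\<not> n \<le> 0"
    then have "real CARD('p) powi (- n) < real CARD('p) powi 0"
      using p1 by (intro power_int_strict_increasing) auto
    then show False using Zp_dual_norm_ge_1[OF assms(1)] norm by simp
  qed
  define m where "m = nat (- n)"
  have n: "n = - int m" using \<open>n \<le> 0\<close> by (simp add: m_def)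
  have unit: "u * t \<in> pow_Zp k \<longleftrightarrow> t \<in> pow_Zp k" for t k
  proof
    assume "u * t \<in> pow_Zp k"
    then have "v * (u * t) \<in> pow_Zp (0 + k)" using u by (intro pow_Zp_mult) simp_all
    moreover have "v * (u * t) = (u * v) * t" by (simp only: ac_simps)
    ultimately show "t \<in> pow_Zp k" by (simp add: u(4))
  next
    assume "t \<in> pow_Zp k"
    then show "u * t \<in> pow_Zp k" using pow_Zp_mult[of u 0 t k] u by simp
  qed
  show thesis
  proof (rule that)
    show "padic_norm \<gamma> = real CARD('p) ^ m" by (simp add: norm n)
    with assms(2) p1 show "m \<le> r" by simp
    show "padic_abs \<gamma> = of_nat CARD('p) powi int m"
      using \<open>\<gamma> \<noteq> 0\<close> by (simp add: padic_abs_def val n)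
    show "\<gamma> * t \<in> pow_Zp k \<longleftrightarrow> t \<in> pow_Zp (k + int m)" for k t
      using powi_mult_in_pow_Zp_iff[of n "u * t" "k + int m"] unit[of t "k + int m"]
      by (simp add: u(1) n mult.assoc)
  qed
qed

section \<open>Cosets of p^m Z_p^d\<close>

text \<open>This is the coset w + p^m Z_p^d in coordinates. With \<bar>\<gamma>\<bar> = p^m it
  serves for the elements of \<open>Zp_quot\<close> and for the values of \<open>padic_proj\<close>
  alike.\<close>

definition vec_coset :: "nat \<Rightarrow> 'p::prime_card padic ^ 'd \<Rightarrow> ('p padic ^ 'd) set" where
  "vec_coset m w = {v. \<forall>i. w $ i - v $ i \<in> pow_Zp (int m)}"

lemma vec_coset_self: "w \<in> vec_coset m w"
  by (simp add: vec_coset_def)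

lemma vec_coset_eq:
  assumes "v \<in> vec_coset m w"
  shows "vec_coset m v = vec_coset m w"
proof -
  have "u \<in> vec_coset m v \<longleftrightarrow> u \<in> vec_coset m w" for u
  proof -
    have "v $ i - u $ i \<in> pow_Zp (int m) \<longleftrightarrow> w $ i - u $ i \<in> pow_Zp (int m)" for i
    proof -
      have i: "w $ i - v $ i \<in> pow_Zp (int m)" using assms by (simp add: vec_coset_def)
      show ?thesis
        using pow_Zp_add[OF i, of "v $ i - u $ i"] pow_Zp_diff[OF _ i, of "w $ i - u $ i"] by auto
    qed
    then show ?thesis by (simp add: vec_coset_def)
  qed
  then show ?thesis by blast
qed

lemma cong_rel_lattice:
  assumes "padic_abs \<gamma> = of_nat CARD('p) powi int m"
  shows "cong_rel (padic_lattice (padic_abs (\<gamma> :: 'p::prime_card padic))) `` {x} = vec_coset m x"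
  unfolding assms cong_rel_def vec_coset_def Image_def by (simp only: padic_lattice_iff) simp

lemma Zp_quot_eq:
  assumes "padic_abs \<gamma> = of_nat CARD('p) powi int m"
  shows "Zp_quot (\<gamma> :: 'p::prime_card padic) = vec_coset m ` vecs Zp"
  by (auto simp: Zp_quot_def quotient_def cong_rel_lattice[OF assms])

lemma coset_rep_in_vec_coset: "coset_rep (vec_coset m w) \<in> vec_coset m w"
  unfolding coset_rep_def using vec_coset_self by (rule someI)

lemma vec_coset_subset_Zp: "w \<in> vecs Zp \<Longrightarrow> vec_coset m w \<subseteq> vecs Zp"
proof
  fix v assume w: "w \<in> vecs Zp" and v: "v \<in> vec_coset m w"
  have "w $ i - v $ i \<in> Zp" for i
    using v pow_Zp_mono[of 0 "int m" "w $ i - v $ i"] by (simp add: vec_coset_def)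
  then have "w $ i - (w $ i - v $ i) \<in> Zp" for i
    by (rule Zp_diff[rotated]) (use w in \<open>simp add: vecs_def\<close>)
  then show "v \<in> vecs Zp" by (simp add: vecs_def)
qed

text \<open>The sum of two cosets is the Minkowski sum, which is the coset of w + x. The indicator
  in a matrix coefficient with indices k + P_\<gamma>(x) and k therefore tests membership in the
  coset of \<open>x\<close>, whatever k is.\<close>

lemma vec_coset_difference:
  assumes "w \<in> vecs Zp"
  shows "{u - v | u v. u \<in> vec_coset m w + vec_coset m x \<and> v \<in> vec_coset m w} = vec_coset m x"
proof (intro equalityI subsetI)
  fix a assume "a \<in> {u - v | u v. u \<in> vec_coset m w + vec_coset m x \<and> v \<in> vec_coset m w}"
  then obtain u u' v where a: "a = u + u' - v" "u \<in> vec_coset m w" "u' \<in> vec_coset m x" "v \<in> vec_coset m w"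
    by (auto elim!: set_plus_elim)
  have "x $ i - a $ i \<in> pow_Zp (int m)" for i
  proof -
    have "(w $ i - u $ i) + (x $ i - u' $ i) - (w $ i - v $ i) \<in> pow_Zp (int m)"
      by (rule pow_Zp_diff[OF pow_Zp_add]) (use a in \<open>simp_all add: vec_coset_def\<close>)
    then show ?thesis by (simp add: a(1) algebra_simps)
  qed
  then show "a \<in> vec_coset m x" by (simp add: vec_coset_def)
next
  fix a assume "a \<in> vec_coset m x"
  then have "w + a \<in> vec_coset m w + vec_coset m x" by (intro set_plus_intro vec_coset_self)
  moreover have "a = (w + a) - w" by simp
  ultimately show "a \<in> {u - v | u v. u \<in> vec_coset m w + vec_coset m x \<and> v \<in> vec_coset m w}"
    using vec_coset_self by blast
qed

section \<open>Character sums over cosets and over pairs (\<alpha>, \<beta>)\<close>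

lemma scalar_product_diff_left: "scalar_product (u - v) w = scalar_product u w - scalar_product v (w :: 'a::comm_ring_1 ^ 'd)"
  by (simp add: scalar_product_def left_diff_distrib sum_subtractf)

lemma scalar_product_diff_right: "scalar_product w (u - v) = scalar_product w u - scalar_product w (v :: 'a::comm_ring_1 ^ 'd)"
  by (simp add: scalar_product_def right_diff_distrib sum_subtractf)

lemma scalar_product_commute: "scalar_product v w = scalar_product w (v :: 'a::comm_ring_1 ^ 'd)"
  by (simp add: scalar_product_def mult.commute)

lemma scalar_product_scale_right: "scalar_product v (c *s w) = c * scalar_product v (w :: 'a::comm_ring_1 ^ 'd)"
  by (simp add: scalar_product_def sum_distrib_left mult.left_commute)

text \<open>Vectors of p^a Z_p^d and p^(-a) Z_p^d pair integrally. This gives independence of the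
  chosen representatives in both sums below.\<close>

lemma padic_char_scalar_product_cong:
  fixes u v t :: "'p::prime_card padic ^ 'd"
  assumes "\<And>i. u $ i - v $ i \<in> pow_Zp a" "\<And>i. t $ i \<in> pow_Zp (- a)"
  shows "padic_char (scalar_product u t) = padic_char (scalar_product v t)"
proof (rule padic_char_cong)
  have "(u - v) $ i * t $ i \<in> Zp" for i
    using pow_Zp_mult[OF assms(1)[of i] assms(2)[of i]] by simp
  then show "scalar_product u t - scalar_product v t \<in> Zp"
    unfolding scalar_product_diff_left[symmetric] by (rule scalar_product_in_Zp)
qed

text \<open>Digit vectors modulo p^m replace the cosets. As \<open>t\<close> has denominators at
  most p^m, the choice made by \<open>coset_rep\<close> does not affect the character, and
  orthogonality applies.\<close>

lemma sum_Zp_quot_char: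
  fixes t :: "'p::prime_card padic ^ 'd"
  assumes "padic_abs \<gamma> = of_nat CARD('p) powi int m" "\<And>i. t $ i \<in> pow_Zp (- int m)"
  shows "(\<Sum>k\<in>Zp_quot \<gamma>. padic_char (scalar_product (coset_rep k) t))
    = (if \<forall>i. t $ i \<in> Zp then of_nat CARD('p) ^ (m * CARD('d)) else 0)"
proof -
  \<comment> \<open>The factor \<open>powi 0\<close> and the exponent \<open>0 + int m\<close> keep
    the shape of \<open>vec_digit_ex1\<close> at a = 0.\<close>
  let ?E = "\<lambda>k f. \<forall>i. coset_rep k $ i - of_nat CARD('p) powi 0 * of_nat (f i) \<in> pow_Zp (0 + int m)"
  have rep: "coset_rep k \<in> vecs Zp" "k = vec_coset m (coset_rep k)"
    if k: "k \<in> Zp_quot \<gamma>" for k :: "('p padic ^ 'd) set"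
  proof -
    obtain w where w: "w \<in> vecs Zp" "k = vec_coset m w" using k by (auto simp: Zp_quot_eq[OF assms(1)])
    show "coset_rep k \<in> vecs Zp" "k = vec_coset m (coset_rep k)"
      using coset_rep_in_vec_coset[of m w] vec_coset_subset_Zp[OF w(1)] vec_coset_eq unfolding w(2) by blast+
  qed
  have "(\<Sum>k\<in>Zp_quot \<gamma>. padic_char (scalar_product (coset_rep k) t))
    = (\<Sum>f\<in>UNIV \<rightarrow>\<^sub>E {..<CARD('p) ^ m}.
        padic_char (scalar_product (\<chi> i. of_nat CARD('p) powi 0 * of_nat (f i)) t))"
  proof (rule sum_correspondence[where E = ?E])
    fix k :: "('p padic ^ 'd) set" assume "k \<in> Zp_quot \<gamma>"
    from rep(1)[OF this] show "\<exists>!f. f \<in> UNIV \<rightarrow>\<^sub>E {..<CARD('p) ^ m} \<and> ?E k f"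
      by (intro vec_digit_ex1) (simp add: vecs_def)
  next
    fix f :: "'d \<Rightarrow> nat"
    define w :: "'p padic ^ 'd" where "w = (\<chi> i. of_nat CARD('p) powi 0 * of_nat (f i))"
    have E: "?E k f \<longleftrightarrow> k = vec_coset m w" if "k \<in> Zp_quot \<gamma>" for k
    proof
      assume "?E k f"
      then have "w \<in> vec_coset m (coset_rep k)" by (simp add: vec_coset_def w_def)
      then show "k = vec_coset m w" using vec_coset_eq rep(2)[OF that] by metis
    next
      assume "k = vec_coset m w"
      then have "w \<in> vec_coset m (coset_rep k)" using rep(2)[OF that] vec_coset_self by metis
      then show "?E k f" by (simp add: vec_coset_def w_def)
    qed
    have "vec_coset m w \<in> Zp_quot \<gamma>"
      unfolding Zp_quot_eq[OF assms(1)] by (rule imageI) (simp add: w_def vecs_def)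
    with E show "\<exists>!k. k \<in> Zp_quot \<gamma> \<and> ?E k f" by blast
  next
    fix k :: "('p padic ^ 'd) set" and f assume "?E k f"
    then show "padic_char (scalar_product (coset_rep k) t)
      = padic_char (scalar_product (\<chi> i. of_nat CARD('p) powi 0 * of_nat (f i)) t)"
      using assms(2) by (intro padic_char_scalar_product_cong[where a = "int m"]) simp_all
  qed
  also have "\<dots> = (if \<forall>i. t $ i \<in> Zp then of_nat CARD('p) ^ (m * CARD('d)) else 0)"
    using sum_padic_char_vec[of t 0 m] assms(2) by simp
  finally show ?thesis .
qed

text \<open>Since the inverse of \<bar>\<gamma>\<bar> is p^(-m), the summation runs over the classes
  of p^(-r) Z_p^(2d) modulo p^(-m) Z_p^(2d). The norm bound depends only on the class because m
  \<le> r, and the character does because \<open>s\<close> and \<open>t\<close> lie in p^m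
  Z_p^d.\<close>

lemma sum_rep_system_char:
  fixes s t :: "'p::prime_card padic ^ 'd"
  assumes "rep_system \<gamma> R" and \<gamma>: "padic_abs \<gamma> = of_nat CARD('p) powi int m" and "m \<le> r"
    and s: "\<And>i. s $ i \<in> pow_Zp (int m)" and t: "\<And>i. t $ i \<in> pow_Zp (int m)"
  shows "(\<Sum>(\<alpha>, \<beta>) | (\<alpha>, \<beta>) \<in> R \<and> padic_vnorm \<alpha> \<le> real CARD('p) ^ r \<and> padic_vnorm \<beta> \<le> real CARD('p) ^ r.
      padic_char (scalar_product s \<alpha> + scalar_product t \<beta>))
    = (if (\<forall>i. s $ i \<in> pow_Zp (int r)) \<and> (\<forall>i. t $ i \<in> pow_Zp (int r))
      then of_nat CARD('p) ^ (2 * (r - m) * CARD('d)) else 0)"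
proof -
  let ?q = "of_nat CARD('p) powi (- int r) :: 'p padic"
  let ?S = "{(\<alpha>, \<beta>). (\<alpha>, \<beta>) \<in> R \<and> padic_vnorm \<alpha> \<le> real CARD('p) ^ r \<and> padic_vnorm \<beta> \<le> real CARD('p) ^ r}"
  let ?T = "(UNIV :: 'd set) \<rightarrow>\<^sub>E {..<CARD('p) ^ (r - m)}"
  let ?v = "\<lambda>f. (\<chi> i. ?q * of_nat (f i)) :: 'p padic ^ 'd"
  define C where "C u f \<longleftrightarrow> (\<forall>i. u $ i - ?q * of_nat (f i) \<in> pow_Zp (- int m))"
    for u :: "'p padic ^ 'd" and f
  let ?E = "\<lambda>v g. C (fst v) (fst g) \<and> C (snd v) (snd g)"
  \<comment> \<open>The subtraction r - m on natural numbers is exact, so r - m digits starting at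
    position -r reach position -m.\<close>
  have exp: "- int r + int (r - m) = - int m" using \<open>m \<le> r\<close> by simp
  have inv: "inverse (padic_abs \<gamma>) = of_nat CARD('p) powi (- int m)" by (simp add: \<gamma> power_int_minus)
  have digits: "\<exists>!f. f \<in> ?T \<and> C u f" if "padic_vnorm u \<le> real CARD('p) ^ r" for u
    using vec_digit_ex1[of u "- int r" "r - m"] that unfolding padic_vnorm_le_power_iff exp C_def by simp
  have bound: "padic_vnorm u \<le> real CARD('p) ^ r" if "C u f" for u f
    unfolding padic_vnorm_le_power_iff
  proof
    fix i
    have "u $ i - ?q * of_nat (f i) \<in> pow_Zp (- int r)"
      using that \<open>m \<le> r\<close> by (auto simp: C_def intro: pow_Zp_mono[of _ "- int m"])
    from pow_Zp_add[OF this powi_mult_of_nat_in_pow_Zp[of "- int r" "f i"]] show "u $ i \<in> pow_Zp (- int r)" by simp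
  qed
  have lat: "?v f - u \<in> padic_lattice (inverse (padic_abs \<gamma>)) \<longleftrightarrow> C u f" for u f
  proof -
    have "?q * of_nat (f i) - u $ i \<in> pow_Zp (- int m) \<longleftrightarrow> u $ i - ?q * of_nat (f i) \<in> pow_Zp (- int m)" for i
      using pow_Zp_uminus[of "?q * of_nat (f i) - u $ i" "- int m"]
        pow_Zp_uminus[of "u $ i - ?q * of_nat (f i)" "- int m"] by auto
    then show ?thesis unfolding inv padic_lattice_iff C_def by simp
  qed
  have "(\<Sum>(\<alpha>, \<beta>)\<in>?S. padic_char (scalar_product s \<alpha> + scalar_product t \<beta>))
    = (\<Sum>(f, g)\<in>?T \<times> ?T. padic_char (scalar_product (?v f) s) * padic_char (scalar_product (?v g) t))"
  proof (rule sum_correspondence[where E = ?E])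
    fix v assume "v \<in> ?S"
    then have v: "padic_vnorm (fst v) \<le> real CARD('p) ^ r" "padic_vnorm (snd v) \<le> real CARD('p) ^ r"
      by auto
    obtain f where f: "f \<in> ?T" "C (fst v) f" "\<And>f'. f' \<in> ?T \<Longrightarrow> C (fst v) f' \<Longrightarrow> f' = f"
      using ex1E[OF digits[OF v(1)]] by metis
    obtain g where g: "g \<in> ?T" "C (snd v) g" "\<And>g'. g' \<in> ?T \<Longrightarrow> C (snd v) g' \<Longrightarrow> g' = g"
      using ex1E[OF digits[OF v(2)]] by metis
    show "\<exists>!h. h \<in> ?T \<times> ?T \<and> ?E v h"
    proof (rule ex1I[of _ "(f, g)"])
      show "(f, g) \<in> ?T \<times> ?T \<and> ?E v (f, g)" using f(1,2) g(1,2) by simp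
    next
      fix h assume "h \<in> ?T \<times> ?T \<and> ?E v h"
      then have "fst h = f" "snd h = g" by (auto intro!: f(3) g(3) simp: mem_Times_iff)
      then show "h = (f, g)" by (simp add: prod_eq_iff)
    qed
  next
    fix h :: "('d \<Rightarrow> nat) \<times> ('d \<Rightarrow> nat)"
    let ?r = "cong_rel (padic_lattice (inverse (padic_abs \<gamma>)) \<times> padic_lattice (inverse (padic_abs \<gamma>)))
      :: ((('p padic ^ 'd) \<times> ('p padic ^ 'd)) \<times> (('p padic ^ 'd) \<times> ('p padic ^ 'd))) set"
    \<comment> \<open>\<open>K\<close> is the class of the pair of digit vectors. The system
      \<open>R\<close> meets it in exactly one point, and \<open>bound\<close> shows that this point
      obeys the norm bounds.\<close>
    define K where "K = ?r `` {(?v (fst h), ?v (snd h))}"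
    have "K \<in> Qp_quot \<gamma>" unfolding Qp_quot_def K_def by (rule quotientI) simp
    then have "\<exists>!v. v \<in> R \<inter> K" using assms(1) unfolding rep_system_def by blast
    moreover have "v \<in> K \<longleftrightarrow> ?E v h" for v
      unfolding K_def cong_rel_def by (cases v) (simp add: lat)
    then have "v \<in> R \<inter> K \<longleftrightarrow> v \<in> ?S \<and> ?E v h" for v
      using bound[of "fst v" "fst h"] bound[of "snd v" "snd h"] by (auto split: prod.splits)
    ultimately show "\<exists>!v. v \<in> ?S \<and> ?E v h" by simp
  next
    fix v h assume "?E v h"
    then have "padic_char (scalar_product (fst v) s) = padic_char (scalar_product (?v (fst h)) s)"
      "padic_char (scalar_product (snd v) t) = padic_char (scalar_product (?v (snd h)) t)"
      using s t by (auto intro!: padic_char_scalar_product_cong[where a = "- int m"] simp: C_def)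
    then show "(case v of (\<alpha>, \<beta>) \<Rightarrow> padic_char (scalar_product s \<alpha> + scalar_product t \<beta>))
      = (case h of (f, g) \<Rightarrow> padic_char (scalar_product (?v f) s) * padic_char (scalar_product (?v g) t))"
      by (simp add: case_prod_beta padic_char_add scalar_product_commute)
  qed
  also have "\<dots> = (\<Sum>f\<in>?T. padic_char (scalar_product (?v f) s)) * (\<Sum>g\<in>?T. padic_char (scalar_product (?v g) t))"
    by (simp only: sum_product sum.cartesian_product)
  also have "(\<Sum>f\<in>?T. padic_char (scalar_product (?v f) s))
      = (if \<forall>i. s $ i \<in> pow_Zp (int r) then of_nat CARD('p) ^ ((r - m) * CARD('d)) else 0)"
    using sum_padic_char_vec[of s "- int r" "r - m"] s unfolding exp by simp
  also have "(\<Sum>g\<in>?T. padic_char (scalar_product (?v g) t))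
      = (if \<forall>i. t $ i \<in> pow_Zp (int r) then of_nat CARD('p) ^ ((r - m) * CARD('d)) else 0)"
    using sum_padic_char_vec[of t "- int r" "r - m"] t unfolding exp by simp
  finally show ?thesis by (simp flip: power_add mult_2 add: mult.assoc)
qed

section \<open>The Heisenberg group\<close>

lemma sum_UNIV_unit_Plus_unit: "(\<Sum>k\<in>(UNIV :: (unit + 'd::finite + unit) set). f k)
    = f (Inl ()) + ((\<Sum>i\<in>UNIV. f (Inr (Inl i))) + f (Inr (Inr ())) :: 'a::comm_monoid_add)"
  unfolding UNIV_Plus_UNIV[symmetric] by (simp add: sum.Plus UNIV_unit)

lemma heis_mult:
  fixes x y x' y' :: "'a::comm_ring_1 ^ 'd"
  shows "heis x y z ** heis x' y' z' = heis (x + x') (y + y') (z + z' + scalar_product x y')"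
proof -
  have "(heis x y z ** heis x' y' z') $ i $ j = heis (x + x') (y + y') (z + z' + scalar_product x y') $ i $ j" for i j
    \<comment> \<open>The tuple lists the arguments of \<open>heis_entry\<close>, so the case rule
      separates the nine blocks of the matrix.\<close>
    by (cases "(x + x', y + y', z + z' + scalar_product x y', i, j)" rule: heis_entry.cases)
      (simp_all add: matrix_matrix_mult_def heis_def sum_UNIV_unit_Plus_unit scalar_product_def if_distrib[of "\<lambda>u. u * _"]
        if_distrib[of "\<lambda>u. _ * u"] sum.delta sum.delta' add_ac cong: if_cong)
  then show ?thesis by (simp add: vec_eq_iff)
qed

lemma heis_eq_iff: "heis x y z = heis x' y' z' \<longleftrightarrow> x = x' \<and> y = y' \<and> z = z'"
  by (metis heis_coords)

lemma heis_in_heis_group_iff: "heis x y z \<in> heis_group A \<longleftrightarrow> x \<in> vecs A \<and> y \<in> vecs A \<and> z \<in> A"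
  by (auto simp: heis_group_def heis_eq_iff)

text \<open>Multiplication by [x,y,z] adds the pairing of \<open>x\<close> with y' to the last
  coordinate. As \<open>x\<close> is integral, this term stays in p^r Z_p, so the three congruences
  decouple.\<close>

lemma heis_coset_iff:
  fixes x y a b :: "'p::prime_card padic ^ 'd"
  assumes "x \<in> vecs Zp"
  shows "heis a b c \<in> (**) (heis x y z) ` heis_group ((*) (of_nat CARD('p) ^ r) ` Zp) \<longleftrightarrow>
    (\<forall>i. (a - x) $ i \<in> pow_Zp (int r)) \<and> (\<forall>i. (b - y) $ i \<in> pow_Zp (int r)) \<and> c - z \<in> pow_Zp (int r)"
    (is "?L \<longleftrightarrow> ?R")
proof -
  have Z: "(*) (of_nat CARD('p) ^ r) ` Zp = (pow_Zp (int r) :: 'p padic set)" by (simp add: pow_Zp_def)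
  have xy: "scalar_product x v \<in> pow_Zp (int r)" if "\<forall>i. v $ i \<in> pow_Zp (int r)" for v
    unfolding scalar_product_def
  proof (rule pow_Zp_sum)
    fix i
    show "x $ i * v $ i \<in> pow_Zp (int r)"
      using pow_Zp_mult[of "x $ i" 0 "v $ i" "int r"] that assms by (simp add: vecs_def)
  qed
  show ?thesis
  proof
    assume ?L
    then obtain h where "h \<in> heis_group (pow_Zp (int r))" "heis a b c = heis x y z ** h"
      unfolding Z by blast
    then obtain x' y' z' where h: "heis a b c = heis x y z ** heis x' y' z'"
      "x' \<in> vecs (pow_Zp (int r))" "y' \<in> vecs (pow_Zp (int r))" "z' \<in> pow_Zp (int r)"
      unfolding heis_group_def by blast
    then have "a = x + x'" "b = y + y'" "c = z + z' + scalar_product x y'"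
      by (simp_all add: heis_mult heis_eq_iff)
    moreover have "z' + scalar_product x y' \<in> pow_Zp (int r)"
      using h by (intro pow_Zp_add xy) (simp_all add: vecs_def)
    ultimately show ?R using h by (simp add: vecs_def add.assoc)
  next
    assume R: ?R
    \<comment> \<open>This is the product of the inverse of [x,y,z] with [a,b,c], found by solving
      \<open>heis_mult\<close> for the right factor.\<close>
    let ?h = "heis (a - x) (b - y) (c - z - scalar_product x (b - y))"
    have "heis a b c = heis x y z ** ?h" by (simp add: heis_mult)
    moreover have "?h \<in> heis_group (pow_Zp (int r))"
      unfolding heis_in_heis_group_iff using R xy[of "b - y"] by (simp add: vecs_def pow_Zp_diff)
    ultimately show ?L unfolding Z by (rule image_eqI)
  qed
qed

section \<open>Evaluation of the triple sum\<close>

text \<open>The identity of functions is stated pointwise at an arbitrary \<open>g\<close> of the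
  group, and \<open>R\<close> is an arbitrary choice of representatives (\<alpha>, \<beta>) for each
  \<gamma>.\<close>

theorem proposition4p5:
  fixes x y :: "'p::prime_card padic ^ 'd" and z :: "'p padic" and r :: nat
    and R :: "'p padic \<Rightarrow> (('p padic ^ 'd) \<times> ('p padic ^ 'd)) set"
    and g :: "('p padic, 'd) heis_matrix"
  assumes "heis x y z \<in> heis_group Zp"
    and "\<And>\<gamma>. \<gamma> \<in> Zp_dual \<Longrightarrow> rep_system \<gamma> (R \<gamma>)"
    and "g \<in> heis_group Zp"
  shows "indicator ((**) (heis x y z) ` heis_group ((*) (of_nat CARD('p) ^ r) ` Zp)) g =
    (\<Sum>\<gamma> | \<gamma> \<in> Zp_dual \<and> padic_norm \<gamma> \<le> real CARD('p) ^ r.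
      \<Sum>(\<alpha>, \<beta>) | (\<alpha>, \<beta>) \<in> R \<gamma> \<and> padic_vnorm \<alpha> \<le> real CARD('p) ^ r \<and> padic_vnorm \<beta> \<le> real CARD('p) ^ r.
        \<Sum>k \<in> Zp_quot \<gamma>.
          of_real (padic_norm \<gamma>) ^ CARD('d)
          * exp (- 2 * pi * \<i> * padic_frac (\<gamma> * (z + scalar_product (coset_rep k) y)
              + scalar_product x \<alpha> + scalar_product y \<beta>))
          / of_nat CARD('p) ^ (r * (2 * CARD('d) + 1))
          * chi_coeff \<alpha> \<beta> \<gamma> (k + padic_proj \<gamma> x) k g)"
proof -
  obtain a b c where g: "g = heis a b c" and abc: "a \<in> vecs Zp" "b \<in> vecs Zp" "c \<in> Zp"
    using assms(3) by (auto simp: heis_group_def)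
  have xyz: "x \<in> vecs Zp" "y \<in> vecs Zp" "z \<in> Zp" using assms(1) by (simp_all add: heis_in_heis_group_iff)
  define P :: complex where "P = of_nat CARD('p)"
  have P: "P \<noteq> 0" by (simp add: P_def)
  define D where "D = r * (2 * CARD('d) + 1)"
  let ?I = "(\<forall>i. (a - x) $ i \<in> pow_Zp (int r)) \<and> (\<forall>i. (b - y) $ i \<in> pow_Zp (int r))"
  \<comment> \<open>With \<bar>\<gamma>\<bar> = p^m, the powers p^(md) from the coefficient, p^(md)
    from the sum over k and p^(2(r-m)d) from the sum over (\<alpha>, \<beta>) multiply to p^(2rd).
    Only the character factor still depends on \<gamma>.\<close>
  have inner: "(\<Sum>(\<alpha>, \<beta>) | (\<alpha>, \<beta>) \<in> R \<gamma> \<and> padic_vnorm \<alpha> \<le> real CARD('p) ^ r \<and> padic_vnorm \<beta> \<le> real CARD('p) ^ r.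
        \<Sum>k \<in> Zp_quot \<gamma>.
          of_real (padic_norm \<gamma>) ^ CARD('d)
          * exp (- 2 * pi * \<i> * padic_frac (\<gamma> * (z + scalar_product (coset_rep k) y)
              + scalar_product x \<alpha> + scalar_product y \<beta>))
          / of_nat CARD('p) ^ D
          * chi_coeff \<alpha> \<beta> \<gamma> (k + padic_proj \<gamma> x) k g)
      = padic_char (\<gamma> * (c - z)) * (if ?I then P ^ (2 * r * CARD('d)) / P ^ D else 0)"
    (is "?sum = _") if \<gamma>: "\<gamma> \<in> Zp_dual" "padic_norm \<gamma> \<le> real CARD('p) ^ r" for \<gamma>
  proof -
    obtain m where "m \<le> r" and norm: "padic_norm \<gamma> = real CARD('p) ^ m"
      and abs: "padic_abs \<gamma> = of_nat CARD('p) powi int m"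
      and mult: "\<And>n t. \<gamma> * t \<in> pow_Zp n \<longleftrightarrow> t \<in> pow_Zp (n + int m)"
      using Zp_dual_absE[OF \<gamma>] by blast
    let ?M = "\<lambda>u :: 'p padic ^ 'd. \<forall>i. u $ i \<in> pow_Zp (int m)"
    \<comment> \<open>Moving \<gamma> into the vector turns the dependence on k into a character of
      the pairing with \<open>?t\<close>.\<close>
    let ?t = "\<gamma> *s (b - y)"
    \<comment> \<open>The two exponentials merge into differences of coordinates, which separates
      the summand into a factor in \<gamma>, a factor in (\<alpha>, \<beta>) and a factor in
      k.\<close>
    have summand: "of_real (padic_norm \<gamma>) ^ CARD('d)
          * exp (- 2 * pi * \<i> * padic_frac (\<gamma> * (z + scalar_product (coset_rep k) y)
              + scalar_product x \<alpha> + scalar_product y \<beta>))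
          / of_nat CARD('p) ^ D
          * chi_coeff \<alpha> \<beta> \<gamma> (k + padic_proj \<gamma> x) k g
        = padic_char (\<gamma> * (c - z)) * (if ?M (a - x) then P ^ (m * CARD('d)) / P ^ D else 0)
          * padic_char (scalar_product (a - x) \<alpha> + scalar_product (b - y) \<beta>)
          * padic_char (scalar_product (coset_rep k) ?t)" if k: "k \<in> Zp_quot \<gamma>" for k \<alpha> \<beta>
    proof -
      obtain w where w: "w \<in> vecs Zp" "k = vec_coset m w" using k by (auto simp: Zp_quot_eq[OF abs])
      have "{u - v | u v. u \<in> k + padic_proj \<gamma> x \<and> v \<in> k} = vec_coset m x"
        unfolding padic_proj_def cong_rel_lattice[OF abs] w(2) by (rule vec_coset_difference[OF w(1)])
      moreover have "a \<in> vec_coset m x \<longleftrightarrow> ?M (a - x)"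
        using pow_Zp_uminus[of "(x - a) $ _" "int m"] pow_Zp_uminus[of "(a - x) $ _" "int m"]
        by (auto simp: vec_coset_def)
      ultimately have chi: "chi_coeff \<alpha> \<beta> \<gamma> (k + padic_proj \<gamma> x) k g
          = padic_char (\<gamma> * (c + scalar_product (coset_rep k) b) + (scalar_product a \<alpha> + scalar_product b \<beta>))
            * (if ?M (a - x) then 1 else 0)"
        unfolding chi_coeff_def g heis_coords padic_char_def by (simp add: indicator_def)
      have "padic_char (- (\<gamma> * (z + scalar_product (coset_rep k) y) + scalar_product x \<alpha> + scalar_product y \<beta>))
          * padic_char (\<gamma> * (c + scalar_product (coset_rep k) b) + (scalar_product a \<alpha> + scalar_product b \<beta>))
        = padic_char (\<gamma> * (c - z)) * padic_char (scalar_product (a - x) \<alpha> + scalar_product (b - y) \<beta>)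
          * padic_char (scalar_product (coset_rep k) ?t)"
        unfolding padic_char_add[symmetric]
        by (rule arg_cong[of _ _ padic_char])
          (simp add: scalar_product_scale_right scalar_product_diff_left scalar_product_diff_right algebra_simps)
      then show ?thesis
        unfolding chi padic_char_uminus[symmetric] norm by (simp add: P_def power_mult)
    qed
    have tm: "?t $ i \<in> pow_Zp (- int m)" for i
      unfolding vector_smult_component mult using abc xyz by (simp add: vecs_def Zp_diff)
    have tZ: "?t $ i \<in> Zp \<longleftrightarrow> (b - y) $ i \<in> pow_Zp (int m)" for i
      unfolding vector_smult_component using mult[of "(b - y) $ i" 0] by (simp only: pow_Zp_0 add_0)
    have "?sum = (\<Sum>(\<alpha>, \<beta>) | (\<alpha>, \<beta>) \<in> R \<gamma> \<and> padic_vnorm \<alpha> \<le> real CARD('p) ^ r \<and> padic_vnorm \<beta> \<le> real CARD('p) ^ r.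
        \<Sum>k \<in> Zp_quot \<gamma>. padic_char (\<gamma> * (c - z)) * (if ?M (a - x) then P ^ (m * CARD('d)) / P ^ D else 0)
          * padic_char (scalar_product (a - x) \<alpha> + scalar_product (b - y) \<beta>)
          * padic_char (scalar_product (coset_rep k) ?t))"
      by (intro sum.cong prod.case_cong refl summand)
    also have "\<dots> = (\<Sum>(\<alpha>, \<beta>) | (\<alpha>, \<beta>) \<in> R \<gamma> \<and> padic_vnorm \<alpha> \<le> real CARD('p) ^ r \<and> padic_vnorm \<beta> \<le> real CARD('p) ^ r.
        padic_char (\<gamma> * (c - z)) * (if ?M (a - x) \<and> ?M (b - y) then P ^ (2 * m * CARD('d)) / P ^ D else 0)
          * padic_char (scalar_product (a - x) \<alpha> + scalar_product (b - y) \<beta>))"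
      unfolding sum_distrib_left[symmetric] sum_Zp_quot_char[OF abs tm] tZ
      by (intro sum.cong prod.case_cong refl) (simp add: P_def mult_2 distrib_right power_add)
    also have "\<dots> = padic_char (\<gamma> * (c - z)) * ((if ?M (a - x) \<and> ?M (b - y) then P ^ (2 * m * CARD('d)) / P ^ D else 0)
        * (\<Sum>(\<alpha>, \<beta>) | (\<alpha>, \<beta>) \<in> R \<gamma> \<and> padic_vnorm \<alpha> \<le> real CARD('p) ^ r \<and> padic_vnorm \<beta> \<le> real CARD('p) ^ r.
          padic_char (scalar_product (a - x) \<alpha> + scalar_product (b - y) \<beta>)))"
      by (simp only: sum_distrib_left case_prod_unfold mult.assoc)
    also have "(if ?M (a - x) \<and> ?M (b - y) then P ^ (2 * m * CARD('d)) / P ^ D else 0)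
        * (\<Sum>(\<alpha>, \<beta>) | (\<alpha>, \<beta>) \<in> R \<gamma> \<and> padic_vnorm \<alpha> \<le> real CARD('p) ^ r \<and> padic_vnorm \<beta> \<le> real CARD('p) ^ r.
          padic_char (scalar_product (a - x) \<alpha> + scalar_product (b - y) \<beta>))
      = (if ?I then P ^ (2 * r * CARD('d)) / P ^ D else 0)"
    proof (cases "?M (a - x) \<and> ?M (b - y)")
      case True
      have "2 * m * CARD('d) + 2 * (r - m) * CARD('d) = 2 * r * CARD('d)"
        using \<open>m \<le> r\<close> by (simp flip: distrib_right distrib_left)
      then have "P ^ (2 * m * CARD('d)) * P ^ (2 * (r - m) * CARD('d)) = P ^ (2 * r * CARD('d))"
        by (simp only: power_add[symmetric])
      moreover have "(\<Sum>(\<alpha>, \<beta>) | (\<alpha>, \<beta>) \<in> R \<gamma> \<and> padic_vnorm \<alpha> \<le> real CARD('p) ^ r \<and> padic_vnorm \<beta> \<le> real CARD('p) ^ r.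
          padic_char (scalar_product (a - x) \<alpha> + scalar_product (b - y) \<beta>))
        = (if ?I then P ^ (2 * (r - m) * CARD('d)) else 0)"
        unfolding P_def using True by (intro sum_rep_system_char[OF assms(2)[OF \<gamma>(1)] abs \<open>m \<le> r\<close>]) blast+
      ultimately show ?thesis using True by (simp only: if_True simp_thms times_divide_eq_left) simp
    next
      case False
      \<comment> \<open>Congruence modulo p^r implies congruence modulo p^m, so a failure at level m
        makes both sides vanish.\<close>
      have "?M u" if "\<forall>i. u $ i \<in> pow_Zp (int r)" for u :: "'p padic ^ 'd"
        using that \<open>m \<le> r\<close> pow_Zp_mono[of "int m" "int r"] by auto
      then have "\<not> ?I" using False by blast
      then show ?thesis using False by (simp only: if_False mult_zero_left)
    qed
    finally show ?thesis .
  qed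
  have "(\<Sum>\<gamma> | \<gamma> \<in> Zp_dual \<and> padic_norm \<gamma> \<le> real CARD('p) ^ r.
      \<Sum>(\<alpha>, \<beta>) | (\<alpha>, \<beta>) \<in> R \<gamma> \<and> padic_vnorm \<alpha> \<le> real CARD('p) ^ r \<and> padic_vnorm \<beta> \<le> real CARD('p) ^ r.
        \<Sum>k \<in> Zp_quot \<gamma>.
          of_real (padic_norm \<gamma>) ^ CARD('d)
          * exp (- 2 * pi * \<i> * padic_frac (\<gamma> * (z + scalar_product (coset_rep k) y)
              + scalar_product x \<alpha> + scalar_product y \<beta>))
          / of_nat CARD('p) ^ D
          * chi_coeff \<alpha> \<beta> \<gamma> (k + padic_proj \<gamma> x) k g)
    = (\<Sum>\<gamma> | \<gamma> \<in> Zp_dual \<and> padic_norm \<gamma> \<le> real CARD('p) ^ r.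
        padic_char (\<gamma> * (c - z)) * (if ?I then P ^ (2 * r * CARD('d)) / P ^ D else 0))"
    by (rule sum.cong[OF refl], rule inner) simp_all
  also have "\<dots> = (\<Sum>\<gamma> | \<gamma> \<in> Zp_dual \<and> padic_norm \<gamma> \<le> real CARD('p) ^ r. padic_char (\<gamma> * (c - z)))
      * (if ?I then P ^ (2 * r * CARD('d)) / P ^ D else 0)"
    by (rule sum_distrib_right[symmetric])
  also have "\<dots> = (if c - z \<in> pow_Zp (int r) then P ^ r else 0)
      * (if ?I then P ^ (2 * r * CARD('d)) / P ^ D else 0)"
    using abc xyz by (simp only: sum_Zp_dual_char Zp_diff P_def)
  also have "\<dots> = (if ?I \<and> c - z \<in> pow_Zp (int r) then 1 else 0)"
  proof -
    \<comment> \<open>The sum over \<gamma> supplies the remaining p^r, so the denominator cancels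
      exactly.\<close>
    have "D = r + 2 * r * CARD('d)" by (simp add: D_def algebra_simps)
    then have "P ^ r * (P ^ (2 * r * CARD('d)) / P ^ D) = 1" using P by (simp add: power_add)
    then show ?thesis
      by (cases "c - z \<in> pow_Zp (int r)"; cases ?I; simp only: if_True if_False simp_thms mult_zero_left mult_zero_right)
  qed
  also have "\<dots> = indicator ((**) (heis x y z) ` heis_group ((*) (of_nat CARD('p) ^ r) ` Zp)) g"
    unfolding g indicator_def heis_coset_iff[OF xyz(1)] by (simp only: conj_assoc of_bool_def)
  finally show ?thesis unfolding D_def by (rule sym)
qed

end
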